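(* Let $T>0$, $\alpha>0$, $\beta>0$, $\sigma>0$, $u_1>0$, let $N$ be a positive integer and $R_0\ge 0$, and consider the optimal control problem $$\int_0^T\big(\alpha R(t)+\beta u(t)\big)\,dt\to\inf,\qquad \dot R(t)=-u(t)R(t)+N\sigma^2,\qquad R(0)=R_0,\qquad 0\le u(t)\le u_1 .$$ Assume $\sqrt{\alpha N\sigma^2/\beta}\le u_1$ and set $u_s=\sqrt{\alpha N\sigma^2/\beta}$. Then the optimal control $\hat u$ has one of the following forms (which one depends on $R_0$ and $T$), for some $0<t_1<t_2<T$: (2.1) $\hat u(t)=0$ for $t\in(0,T)$; (2.2) $\hat u(t)=u_1$ on $(0,t_1)$ and $\hat u(t)=0$ on $(t_1,T)$; (2.3) $\hat u(t)=u_s$ on $(0,t_1)$ and $\hat u(t)=0$ on $(t_1,T)$; (2.4) $\hat u(t)=0$ on $(0,t_1)$, $\hat u(t)=u_s$ on $(t_1,t_2)$, $\hat u(t)=0$ on $(t_2,T)$; (2.5) $\hat u(t)=u_1$ on $(0,t_1)$, $\hat u(t)=u_s$ on $(t_1,t_2)$, $\hat u(t)=0$ on $(t_2,T)$. In particular, the number of switchings of the optimal control does not exceed two, and the optimal control may contain singular arcs (on which $\hat u=u_s$), as in cases (2.3)–(2.5).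
   Context: Admissible controls are functions $u\in L^\infty[0,T]$ with $0\le u(t)\le u_1$ for a.e. $t$ (identified up to a.e. equality); the corresponding state $R$ is the absolutely continuous solution of $\dot R=-uR+N\sigma^2$, $R(0)=R_0$. An optimal control is an admissible control minimizing the integral functional. *)

theory Defs
  imports "HOL-Analysis.Analysis"
begin

definition admissible :: "real \<Rightarrow> real \<Rightarrow> (real \<Rightarrow> real) \<Rightarrow> bool" where
  "admissible T u1 u \<longleftrightarrow>
     u measurable_on {0..T} \<and>
     negligible {t \<in> {0..T}. \<not> (0 \<le> u t \<and> u t \<le> u1)}"

text \<open>R is the (absolutely continuous, Caratheodory) solution of
  R' = -u R + N sigma^2, R(0) = R0 on [0,T], written in integral form.\<close>
definition is_state :: "real \<Rightarrow> nat \<Rightarrow> real \<Rightarrow> real \<Rightarrow> (real \<Rightarrow> real) \<Rightarrow> (real \<Rightarrow> real) \<Rightarrow> bool" where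
  "is_state T N \<sigma> R0 u R \<longleftrightarrow>
     (\<forall>t\<in>{0..T}. ((\<lambda>s. - u s * R s + real N * \<sigma>\<^sup>2) has_integral (R t - R0)) {0..t})"

definition cost :: "real \<Rightarrow> real \<Rightarrow> real \<Rightarrow> (real \<Rightarrow> real) \<Rightarrow> (real \<Rightarrow> real) \<Rightarrow> real" where
  "cost T \<alpha> \<beta> u R = integral {0..T} (\<lambda>t. \<alpha> * R t + \<beta> * u t)"

definition optimal_control ::
  "real \<Rightarrow> real \<Rightarrow> real \<Rightarrow> real \<Rightarrow> real \<Rightarrow> nat \<Rightarrow> real \<Rightarrow> (real \<Rightarrow> real) \<Rightarrow> bool" where
  "optimal_control T \<alpha> \<beta> \<sigma> u1 N R0 u \<longleftrightarrow>
     admissible T u1 u \<and>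
     (\<exists>R. is_state T N \<sigma> R0 u R \<and>
        (\<forall>v S. admissible T u1 v \<longrightarrow> is_state T N \<sigma> R0 v S \<longrightarrow>
               cost T \<alpha> \<beta> u R \<le> cost T \<alpha> \<beta> v S))"

text \<open>Equality almost everywhere on [0,T] (controls are identified up to a.e. equality).\<close>
definition ae_eq_on :: "real \<Rightarrow> (real \<Rightarrow> real) \<Rightarrow> (real \<Rightarrow> real) \<Rightarrow> bool" where
  "ae_eq_on T u v \<longleftrightarrow> negligible {t \<in> {0..T}. u t \<noteq> v t}"

end

theory Submission
  imports Defs
begin

text \<open>
  With \<open>a = N \<sigma>\<^sup>2\<close> and the singular level \<open>R\<^sub>s = a / u\<^sub>s\<close>, i.e. \<open>\<alpha> R\<^sub>s\<^sup>2 = a \<beta>\<close>,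
  the cost of a control admits three expressions, obtained by integrating the derivatives of \<open>(R - 2 R\<^sub>s)\<^sup>2\<close>, \<open>(T - t) R\<close> and \<open>ln R\<close>:
  up to terms depending only on \<open>R\<^sub>0\<close> and \<open>T\<close> it equals
  \<open>\<alpha>/(2a) (R(T) - 2 R\<^sub>s)\<^sup>2 + \<alpha>/a \<integral> u (R - R\<^sub>s)\<^sup>2\<close>, and \<open>\<integral> u (\<beta> - \<alpha> (T - t) R)\<close>, and
  (if \<open>R\<^sub>0 > 0\<close>) \<open>\<integral> (\<alpha> R + \<beta> a / R) - \<beta> ln R(T)\<close>.
  The second one settles the cases where \<open>u = 0\<close> is optimal. The first one settles
  \<open>R\<^sub>0 \<le> R\<^sub>s\<close>, where both of its terms can be made to vanish. The third one is strictly convex in \<open>R\<close>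
  and settles \<open>R\<^sub>0 > R\<^sub>s\<close>. In each case equality forces the control almost everywhere.
\<close>

subsection \<open>Lipschitz primitives of bounded functions\<close>

text \<open>Encodes a Lipschitz \<open>F\<close> whose derivative is \<open>f\<close> almost
  everywhere. Asking for a bound on \<open>f\<close> at every point keeps later estimates free of
  exceptional null sets.\<close>

definition bdd_primitive :: "real \<Rightarrow> real \<Rightarrow> (real \<Rightarrow> real) \<Rightarrow> (real \<Rightarrow> real) \<Rightarrow> bool" where
  "bdd_primitive a b F f \<longleftrightarrow> bounded (f ` {a..b}) \<and>
     (\<forall>s t. a \<le> s \<longrightarrow> s \<le> t \<longrightarrow> t \<le> b \<longrightarrow> (f has_integral (F t - F s)) {s..t})"

lemma bdd_primitive_integral:
  "bdd_primitive a b F f \<Longrightarrow> a \<le> s \<Longrightarrow> s \<le> t \<Longrightarrow> t \<le> b \<Longrightarrow> (f has_integral (F t - F s)) {s..t}"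
  by (auto simp: bdd_primitive_def)

lemma bdd_primitive_subinterval:
  "bdd_primitive a b F f \<Longrightarrow> a \<le> c \<Longrightarrow> d \<le> b \<Longrightarrow> bdd_primitive c d F f"
  unfolding bdd_primitive_def by (force intro: bounded_subset)

lemma bdd_primitive_bound:
  assumes "bdd_primitive a b F f"
  obtains L where "L > 0" "\<And>t. t \<in> {a..b} \<Longrightarrow> \<bar>f t\<bar> \<le> L"
    "\<And>s t. s \<in> {a..b} \<Longrightarrow> t \<in> {a..b} \<Longrightarrow> \<bar>F t - F s\<bar> \<le> L * \<bar>t - s\<bar>"
proof -
  obtain L where L: "L > 0" "\<And>t. t \<in> {a..b} \<Longrightarrow> \<bar>f t\<bar> \<le> L"
    using assms unfolding bdd_primitive_def bounded_pos by (auto simp: image_iff)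
  have *: "\<bar>F t - F s\<bar> \<le> L * \<bar>t - s\<bar>" if "s \<in> {a..b}" "t \<in> {a..b}" "s \<le> t" for s t
  proof -
    have "norm (F t - F s) \<le> L * measure lborel (cbox s t)"
      using assms that L unfolding bdd_primitive_def
      by (intro has_integral_bound[where f = f]) auto
    then show ?thesis using that by simp
  qed
  have "\<bar>F t - F s\<bar> \<le> L * \<bar>t - s\<bar>" if "s \<in> {a..b}" "t \<in> {a..b}" for s t
    using *[OF that] *[OF that(2,1)] by (cases "s \<le> t") (auto simp: abs_minus_commute)
  then show thesis using that L by blast
qed

lemma bdd_primitive_continuous_on:
  assumes "bdd_primitive a b F f"
  shows "continuous_on {a..b} F"
proof -
  obtain L where L: "L > 0" "\<And>s t. s \<in> {a..b} \<Longrightarrow> t \<in> {a..b} \<Longrightarrow> \<bar>F t - F s\<bar> \<le> L * \<bar>t - s\<bar>"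
    using bdd_primitive_bound[OF assms] by metis
  show ?thesis
    unfolding continuous_on_iff dist_real_def
  proof (intro ballI allI impI)
    fix x e :: real assume "x \<in> {a..b}" "e > 0"
    then show "\<exists>d>0. \<forall>x'\<in>{a..b}. \<bar>x' - x\<bar> < d \<longrightarrow> \<bar>F x' - F x\<bar> < e"
      using L(1) by (intro exI[of _ "e / L"])
        (auto simp: field_simps intro!: le_less_trans[OF L(2)])
  qed
qed

lemma bdd_primitive_abs_integrable:
  assumes "bdd_primitive a b F f" "a \<le> b"
  shows "f absolutely_integrable_on {a..b}"
proof -
  obtain L where "L > 0" "\<And>t. t \<in> {a..b} \<Longrightarrow> \<bar>f t\<bar> \<le> L"
    using bdd_primitive_bound[OF assms(1)] by metis
  moreover have "f integrable_on {a..b}"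
    using assms unfolding bdd_primitive_def by (auto simp: integrable_on_def)
  ultimately show ?thesis
    by (intro absolutely_integrable_integrable_bound[where g = "\<lambda>_. L"]) auto
qed

lemma bdd_primitive_cont_mult_integrable:
  assumes "bdd_primitive a b F f" "a \<le> b" "continuous_on {a..b} (h :: real \<Rightarrow> real)"
  shows "(\<lambda>t. h t * f t) integrable_on {a..b}"
proof -
  have "(\<lambda>t. h t * f t) absolutely_integrable_on {a..b}"
    using assms bdd_primitive_abs_integrable[OF assms(1,2)]
    by (intro absolutely_integrable_bounded_measurable_product_real)
       (auto simp: compact_imp_bounded compact_continuous_image
             intro: continuous_imp_measurable_on_sets_lebesgue)
  then show ?thesis by (simp add: absolutely_integrable_on_def)
qed

lemma bdd_primitive_indefinite:
  assumes "bounded (f ` {a..b})" "f integrable_on {a..b}"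
  shows "bdd_primitive a b (\<lambda>t. integral {a..t} f) f"
  unfolding bdd_primitive_def
proof (intro conjI allI impI assms(1))
  fix s t assume st: "a \<le> s" "s \<le> t" "t \<le> b"
  have "f integrable_on {a..t}" "f integrable_on {s..t}"
    using assms(2) st by (auto elim!: integrable_on_subinterval)
  moreover have "integral {a..s} f + integral {s..t} f = integral {a..t} f"
    using st \<open>f integrable_on {a..t}\<close> by (intro Henstock_Kurzweil_Integration.integral_combine) auto
  ultimately show "(f has_integral integral {a..t} f - integral {a..s} f) {s..t}"
    by (simp add: has_integral_iff algebra_simps)
qed

lemma bdd_primitive_cmult:
  assumes F: "bdd_primitive a b F f"
  shows "bdd_primitive a b (\<lambda>t. c * F t) (\<lambda>t. c * f t)"
  unfolding bdd_primitive_def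
proof (intro conjI allI impI)
  show "bounded ((\<lambda>t. c * f t) ` {a..b})"
    using F bounded_scaleR_comp[of f "{a..b}" c] by (simp add: bdd_primitive_def)
  fix s t assume "a \<le> s" "s \<le> t" "t \<le> b"
  from has_integral_mult_right[OF bdd_primitive_integral[OF F this], of c]
  show "((\<lambda>t. c * f t) has_integral c * F t - c * F s) {s..t}"
    by (simp add: right_diff_distrib)
qed

lemma bdd_primitive_add:
  assumes F: "bdd_primitive a b F f" and G: "bdd_primitive a b G g"
  shows "bdd_primitive a b (\<lambda>t. F t + G t) (\<lambda>t. f t + g t)"
  unfolding bdd_primitive_def
proof (intro conjI allI impI)
  show "bounded ((\<lambda>t. f t + g t) ` {a..b})"
    using F G by (intro bounded_plus_comp) (auto simp: bdd_primitive_def)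
  fix s t assume "a \<le> s" "s \<le> t" "t \<le> b"
  from has_integral_add[OF bdd_primitive_integral[OF F this] bdd_primitive_integral[OF G this]]
  show "((\<lambda>t. f t + g t) has_integral F t + G t - (F s + G s)) {s..t}"
    by (simp add: add_diff_add)
qed

lemma bdd_primitive_diff:
  assumes "bdd_primitive a b F f" "bdd_primitive a b G g"
  shows "bdd_primitive a b (\<lambda>t. F t - G t) (\<lambda>t. f t - g t)"
  using bdd_primitive_add[OF assms(1) bdd_primitive_cmult[OF assms(2), of "-1"]] by simp

lemma bdd_primitive_cong:
  assumes "bdd_primitive a b F f" "\<And>t. t \<in> {a..b} \<Longrightarrow> F t = G t" "\<And>t. t \<in> {a..b} \<Longrightarrow> f t = g t"
  shows "bdd_primitive a b G g"
  unfolding bdd_primitive_def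
proof (intro conjI allI impI)
  show "bounded (g ` {a..b})"
    using assms(1,3) unfolding bdd_primitive_def by (metis (no_types, lifting) image_cong)
  fix s t assume "a \<le> s" "s \<le> t" "t \<le> b"
  with bdd_primitive_integral[OF assms(1) this] assms(2)[of s] assms(2)[of t]
  show "(g has_integral G t - G s) {s..t}"
    using assms(3) by (auto intro: has_integral_eq[rotated])
qed

lemma bdd_primitive_C1:
  assumes "\<And>t. t \<in> {a..b} \<Longrightarrow> (F has_real_derivative f t) (at t within {a..b})"
    and "continuous_on {a..b} f"
  shows "bdd_primitive a b F f"
  unfolding bdd_primitive_def
proof (intro conjI allI impI)
  show "bounded (f ` {a..b})"
    using assms(2) by (simp add: compact_imp_bounded compact_continuous_image)
  fix s t assume st: "a \<le> s" "s \<le> t" "t \<le> b"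
  show "(f has_integral F t - F s) {s..t}"
  proof (rule fundamental_theorem_of_calculus[OF st(2)])
    fix x assume "x \<in> {s..t}"
    then have "(F has_real_derivative f x) (at x within {a..b})"
      using st by (intro assms(1)) auto
    then have "(F has_real_derivative f x) (at x within {s..t})"
      by (rule has_field_derivative_subset) (use st in auto)
    then show "(F has_vector_derivative f x) (at x within {s..t})"
      by (simp add: has_real_derivative_iff_has_vector_derivative)
  qed
qed

text \<open>Serves functions glued from several arcs, whose derivative jumps at the points of
  \<open>K\<close>.\<close>

lemma bdd_primitive_piecewise:
  assumes "finite K" "continuous_on {a..b} F" "bounded (f ` {a..b})"
    and deriv: "\<And>x. x \<in> {a<..<b} - K \<Longrightarrow> (F has_real_derivative f x) (at x)"
  shows "bdd_primitive a b F f"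
  unfolding bdd_primitive_def
proof (intro conjI allI impI assms(3))
  fix s t assume st: "a \<le> s" "s \<le> t" "t \<le> b"
  show "(f has_integral F t - F s) {s..t}"
  proof (rule fundamental_theorem_of_calculus_interior_strong[OF assms(1) st(2)])
    show "continuous_on {s..t} F"
      using continuous_on_subset[OF assms(2)] st by auto
    fix x assume "x \<in> {s<..<t} - K"
    then show "(F has_vector_derivative f x) (at x)"
      using deriv st by (simp flip: has_real_derivative_iff_has_vector_derivative)
  qed
qed

lemma bdd_primitive_mono:
  assumes "bdd_primitive a b F f" "\<And>t. t \<in> {a..b} \<Longrightarrow> f t \<ge> 0" "a \<le> s" "s \<le> t" "t \<le> b"
  shows "F s \<le> F t"
  using has_integral_nonneg[OF bdd_primitive_integral[OF assms(1,3-5)]] assms by auto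

section \<open>Chain and product rules for Lipschitz primitives\<close>

text \<open>The assumption says that the derivative is zero at every point. It can be checked for a
  difference of two functions neither of which is known to be differentiable.\<close>

lemma const_if_small_increments:
  fixes D :: "real \<Rightarrow> real"
  assumes "\<And>x e. x \<in> {a..b} \<Longrightarrow> e > 0 \<Longrightarrow>
      \<exists>d>0. \<forall>y\<in>{a..b}. \<bar>y - x\<bar> < d \<longrightarrow> \<bar>D y - D x\<bar> \<le> e * \<bar>y - x\<bar>"
    and "s \<in> {a..b}" "t \<in> {a..b}"
  shows "D s = D t"
proof -
  have "(D has_derivative (\<lambda>h. 0)) (at x within {a..b})" if "x \<in> {a..b}" for x
    unfolding has_derivative_within_alt using assms(1)[OF that] by (auto simp: bounded_linear_zero)
  then obtain c where "\<And>x. x \<in> {a..b} \<Longrightarrow> D x = c"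
    using has_derivative_zero_constant[of "{a..b}" D] by auto
  with assms show ?thesis by auto
qed

lemma bdd_primitive_cont_mult:
  assumes F: "bdd_primitive a b F f" and ab: "a \<le> b" and h: "continuous_on {a..b} h"
  shows "bdd_primitive a b (\<lambda>t. integral {a..t} (\<lambda>r. h r * f r)) (\<lambda>t. h t * f t)"
proof (rule bdd_primitive_indefinite)
  obtain L where L: "L > 0" "\<And>t. t \<in> {a..b} \<Longrightarrow> \<bar>f t\<bar> \<le> L"
    using bdd_primitive_bound[OF F] by metis
  have "bounded (h ` {a..b})"
    using h by (simp add: compact_imp_bounded compact_continuous_image)
  then obtain B where B: "B > 0" "\<And>t. t \<in> {a..b} \<Longrightarrow> \<bar>h t\<bar> \<le> B"
    unfolding bounded_pos by auto
  show "bounded ((\<lambda>t. h t * f t) ` {a..b})"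
    unfolding bounded_pos
    using L B by (intro exI[of _ "B * L"]) (auto simp: abs_mult intro!: mult_mono)
  show "(\<lambda>r. h r * f r) integrable_on {a..b}"
    by (rule bdd_primitive_cont_mult_integrable[OF F ab h])
qed

text \<open>Near \<open>x\<close> the factor \<open>h\<close> is within \<open>e / L\<close> of
  \<open>h x\<close>, and \<open>f\<close> is bounded by \<open>L\<close>. Freezing \<open>h\<close>
  at \<open>h x\<close> under the integral therefore costs at most \<open>e\<close> per unit
  length.\<close>

lemma bdd_primitive_cont_mult_increments:
  assumes F: "bdd_primitive a b F f" and H: "bdd_primitive a b H (\<lambda>t. h t * f t)"
    and h: "continuous_on {a..b} h" and x: "x \<in> {a..b}" and e: "e > 0"
  shows "\<exists>d>0. \<forall>y\<in>{a..b}. \<bar>y - x\<bar> < d \<longrightarrow> \<bar>H y - H x - h x * (F y - F x)\<bar> \<le> e * \<bar>y - x\<bar>"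
proof -
  obtain L where L: "L > 0" "\<And>t. t \<in> {a..b} \<Longrightarrow> \<bar>f t\<bar> \<le> L"
    using bdd_primitive_bound[OF F] by metis
  have "e / L > 0" using e L by simp
  then obtain d where d: "d > 0" "\<And>y. y \<in> {a..b} \<Longrightarrow> \<bar>y - x\<bar> < d \<Longrightarrow> \<bar>h y - h x\<bar> < e / L"
    using h x unfolding continuous_on_iff dist_real_def by metis
  have key: "\<bar>(H t - H s) - h x * (F t - F s)\<bar> \<le> e * (t - s)"
    if st: "s \<le> t" "{s..t} \<subseteq> {a..b}" "\<And>r. r \<in> {s..t} \<Longrightarrow> \<bar>r - x\<bar> < d" for s t
  proof -
    have "((\<lambda>t. h t * f t) has_integral H t - H s) {s..t}" "(f has_integral F t - F s) {s..t}"
      using st by (auto intro!: bdd_primitive_integral[OF H] bdd_primitive_integral[OF F])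
    then have "((\<lambda>r. h r * f r - h x * f r) has_integral (H t - H s) - h x * (F t - F s)) (cbox s t)"
      by (auto intro!: has_integral_diff has_integral_mult_right)
    moreover have "norm (h r * f r - h x * f r) \<le> e" if "r \<in> cbox s t" for r
    proof -
      have r: "r \<in> {a..b}" "\<bar>r - x\<bar> < d" using st that by auto
      then have "\<bar>h r - h x\<bar> * \<bar>f r\<bar> \<le> e / L * L"
        using d(2)[of r] L e by (intro mult_mono) (auto simp: less_imp_le)
      then show ?thesis using L by (simp add: abs_mult flip: left_diff_distrib)
    qed
    ultimately have "norm ((H t - H s) - h x * (F t - F s)) \<le> e * measure lborel (cbox s t)"
      using e by (intro has_integral_bound) auto
    then show ?thesis using st by simp
  qed
  have "\<bar>H y - H x - h x * (F y - F x)\<bar> \<le> e * \<bar>y - x\<bar>" if y: "y \<in> {a..b}" "\<bar>y - x\<bar> < d" for y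
  proof (cases "x \<le> y")
    case True
    then show ?thesis using key[of x y] x y by auto
  next
    case False
    then have "\<bar>(H x - H y) - h x * (F x - F y)\<bar> \<le> e * (x - y)"
      using x y by (intro key) auto
    then show ?thesis using False by (simp add: abs_if algebra_simps split: if_splits)
  qed
  then show ?thesis using d by blast
qed

text \<open>No almost everywhere differentiation is needed for the chain rule: the difference of the two
  sides has increments \<open>o(\<bar>y - x\<bar>)\<close> at every point.\<close>

lemma bdd_primitive_chain:
  assumes F: "bdd_primitive a b F f" and ab: "a \<le> b"
    and I: "\<And>t. t \<in> {a..b} \<Longrightarrow> F t \<in> I"
    and \<phi>: "\<And>r. r \<in> I \<Longrightarrow> (\<phi> has_real_derivative \<phi>' r) (at r within I)"
    and cont: "continuous_on I \<phi>'"
  shows "bdd_primitive a b (\<lambda>t. \<phi> (F t)) (\<lambda>t. \<phi>' (F t) * f t)"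
proof -
  obtain L where L: "L > 0"
     "\<And>s t. s \<in> {a..b} \<Longrightarrow> t \<in> {a..b} \<Longrightarrow> \<bar>F t - F s\<bar> \<le> L * \<bar>t - s\<bar>"
    using bdd_primitive_bound[OF F] by metis
  let ?h = "\<lambda>t. \<phi>' (F t)"
  have h: "continuous_on {a..b} ?h"
    by (rule continuous_on_compose2[OF cont bdd_primitive_continuous_on[OF F]]) (use I in auto)
  define H where "H = (\<lambda>t. integral {a..t} (\<lambda>r. ?h r * f r))"
  have H: "bdd_primitive a b H (\<lambda>t. ?h t * f t)"
    unfolding H_def by (rule bdd_primitive_cont_mult[OF F ab h])
  define D where "D = (\<lambda>t. \<phi> (F t) - H t)"
  have incr: "\<exists>d>0. \<forall>y\<in>{a..b}. \<bar>y - x\<bar> < d \<longrightarrow> \<bar>D y - D x\<bar> \<le> e * \<bar>y - x\<bar>"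
    if x: "x \<in> {a..b}" and e: "e > 0" for x e
  proof -
    let ?e = "e / (2 * L)"
    have e': "?e > 0" "e / 2 > 0" using e L by simp_all
    have "(\<phi> has_derivative (\<lambda>h. \<phi>' (F x) * h)) (at (F x) within I)"
      using \<phi>[OF I[OF x]] by (simp add: has_field_derivative_def)
    then obtain d1 where d1: "d1 > 0"
      "\<And>r. r \<in> I \<Longrightarrow> \<bar>r - F x\<bar> < d1 \<Longrightarrow> \<bar>\<phi> r - \<phi> (F x) - \<phi>' (F x) * (r - F x)\<bar> \<le> ?e * \<bar>r - F x\<bar>"
      unfolding has_derivative_within_alt using e'(1) by (metis real_norm_def)
    obtain d2 where d2: "d2 > 0" "\<And>y. y \<in> {a..b} \<Longrightarrow> \<bar>y - x\<bar> < d2 \<Longrightarrow>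
        \<bar>H y - H x - ?h x * (F y - F x)\<bar> \<le> e / 2 * \<bar>y - x\<bar>"
      using bdd_primitive_cont_mult_increments[OF F H h x e'(2)] by blast
    define d where "d = min (d1 / L) d2"
    have "d > 0" using d1 d2 L by (simp add: d_def)
    moreover have "\<bar>D y - D x\<bar> \<le> e * \<bar>y - x\<bar>" if y: "y \<in> {a..b}" "\<bar>y - x\<bar> < d" for y
    proof -
      have Fy: "\<bar>F y - F x\<bar> \<le> L * \<bar>y - x\<bar>" using L x y by auto
      also have "\<dots> < d1" using y L by (simp add: d_def field_simps)
      finally have "\<bar>\<phi> (F y) - \<phi> (F x) - \<phi>' (F x) * (F y - F x)\<bar> \<le> ?e * \<bar>F y - F x\<bar>"
        using d1 I y by blast
      also have "\<dots> \<le> ?e * (L * \<bar>y - x\<bar>)" using Fy e' by (intro mult_left_mono) auto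
      finally have 1: "\<bar>\<phi> (F y) - \<phi> (F x) - \<phi>' (F x) * (F y - F x)\<bar> \<le> e / 2 * \<bar>y - x\<bar>"
        using L by simp
      have 2: "\<bar>(H y - H x) - \<phi>' (F x) * (F y - F x)\<bar> \<le> e / 2 * \<bar>y - x\<bar>"
        using d2 y by (simp add: d_def)
      have "D y - D x = (\<phi> (F y) - \<phi> (F x) - \<phi>' (F x) * (F y - F x))
          - ((H y - H x) - \<phi>' (F x) * (F y - F x))" by (simp add: D_def)
      then show ?thesis using 1 2 by linarith
    qed
    ultimately show ?thesis by blast
  qed
  have Dc: "D s = D a" if "s \<in> {a..b}" for s
    using const_if_small_increments[of a b D s a] incr that ab by auto
  have "H t = \<phi> (F t) - D a" if "t \<in> {a..b}" for t
    using Dc[OF that] by (simp add: D_def)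
  then have "\<phi> (F t) - \<phi> (F s) = H t - H s" if "s \<in> {a..b}" "t \<in> {a..b}" for s t
    using that by simp
  then show ?thesis
    using H unfolding bdd_primitive_def by simp
qed

lemma bdd_primitive_power:
  assumes "bdd_primitive a b F f" "a \<le> b"
  shows "bdd_primitive a b (\<lambda>t. F t ^ n) (\<lambda>t. of_nat n * F t ^ (n - 1) * f t)"
proof (rule bdd_primitive_chain[OF assms, of UNIV])
  show "((\<lambda>r. r ^ n) has_real_derivative of_nat n * r ^ (n - 1)) (at r within UNIV)" for r :: real
    by (auto intro!: derivative_eq_intros)
  show "continuous_on UNIV (\<lambda>r :: real. of_nat n * r ^ (n - 1))"
    by (intro continuous_intros)
qed auto

text \<open>Polarization writes the product as a quarter of \<open>(F + G)^2 - (F - G)^2\<close>, so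
  the chain rule for squares suffices.\<close>

lemma bdd_primitive_mult:
  assumes "bdd_primitive a b F f" "bdd_primitive a b G g" "a \<le> b"
  shows "bdd_primitive a b (\<lambda>t. F t * G t) (\<lambda>t. f t * G t + F t * g t)"
proof -
  have "bdd_primitive a b (\<lambda>t. 1/4 * ((F t + G t)^2 - (F t - G t)^2))
      (\<lambda>t. 1/4 * (of_nat 2 * (F t + G t)^(2-1) * (f t + g t) - of_nat 2 * (F t - G t)^(2-1) * (f t - g t)))"
    using assms
    by (intro bdd_primitive_cmult bdd_primitive_diff bdd_primitive_power bdd_primitive_add) auto
  then show ?thesis
    by (rule bdd_primitive_cong) (simp_all add: power2_eq_square algebra_simps)
qed

text \<open>Measurability makes \<open>f\<close> an almost everywhere limit of continuous \<open>h\<close>; as \<open>\<integral> h f = 0\<close> for all of them,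
  \<open>\<integral> f\<^sup>2 = 0\<close> by dominated convergence.\<close>

lemma bdd_primitive_const_imp_negligible:
  assumes F: "bdd_primitive a b F f" and ab: "a \<le> b"
    and const: "\<And>t. t \<in> {a..b} \<Longrightarrow> F t = F a"
  shows "negligible {t \<in> {a..b}. f t \<noteq> 0}"
proof -
  have zero: "integral {a..b} (\<lambda>t. h t * f t) = 0" if h: "continuous_on {a..b} h" for h
  proof -
    define H where "H = (\<lambda>t. integral {a..t} (\<lambda>r. h r * f r))"
    have H: "bdd_primitive a b H (\<lambda>t. h t * f t)"
      unfolding H_def by (rule bdd_primitive_cont_mult[OF F ab h])
    have "H b = H a"
    \<comment> \<open>As \<open>F\<close> is constant, the linear term of the increment estimate
      drops out and \<open>H\<close> has derivative zero everywhere.\<close>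
    proof (rule const_if_small_increments[of a b H])
      fix x e :: real assume x: "x \<in> {a..b}" and e: "e > 0"
      have "F y - F x = 0" if "y \<in> {a..b}" for y
        using const[OF x] const[OF that] by simp
      with bdd_primitive_cont_mult_increments[OF F H h x e]
      show "\<exists>d>0. \<forall>y\<in>{a..b}. \<bar>y - x\<bar> < d \<longrightarrow> \<bar>H y - H x\<bar> \<le> e * \<bar>y - x\<bar>"
        by simp
    qed (use ab in auto)
    then show ?thesis by (simp add: H_def)
  qed
  obtain L where L: "L > 0" "\<And>t. t \<in> {a..b} \<Longrightarrow> \<bar>f t\<bar> \<le> L"
    using bdd_primitive_bound[OF F] by metis
  have fint: "f absolutely_integrable_on {a..b}"
    by (rule bdd_primitive_abs_integrable[OF F ab])
  then have "f measurable_on {a..b}"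
    by (simp add: measurable_on_iff_borel_measurable absolutely_integrable_imp_borel_measurable)
  then obtain N g where N: "negligible N" and g: "\<And>n. continuous_on UNIV (g n)"
      "\<And>x. x \<notin> N \<Longrightarrow> (\<lambda>n. g n x) \<longlonglongrightarrow> (if x \<in> {a..b} then f x else 0)"
    unfolding measurable_on_def by blast
  \<comment> \<open>Clipping to \<open>[-L, L]\<close> provides a constant dominating function and
    keeps the limit, because \<open>f\<close> itself takes values in that range.\<close>
  define k where "k = (\<lambda>n x. max (- L) (min L (g n x)))"
  have k: "continuous_on {a..b} (k n)" for n
    unfolding k_def
    by (intro continuous_intros continuous_on_subset[OF g(1)]) auto
  have kL: "\<bar>k n x\<bar> \<le> L" for n x using L by (auto simp: k_def)
  \<comment> \<open>Setting everything to zero on \<open>N\<close> makes the convergence hold at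
    every point of the interval.\<close>
  let ?f = "\<lambda>t. if t \<in> N then 0 else f t"
  let ?q = "\<lambda>n t. if t \<in> N then 0 else k n t * f t"
  have qz: "(?q n has_integral 0) {a..b}" for n
  proof (rule has_integral_spike[OF N])
    show "((\<lambda>t. k n t * f t) has_integral 0) {a..b}"
      using zero[OF k] bdd_primitive_cont_mult_integrable[OF F ab k] by (simp add: has_integral_iff)
  qed auto
  have "((\<lambda>t. ?f t * ?f t) has_integral 0) {a..b}"
  proof (rule has_integral_dominated_convergence[OF qz])
    show "(\<lambda>_. L * L) integrable_on {a..b}" by (rule integrable_const_ivl)
    show "\<forall>x\<in>{a..b}. norm (?q n x) \<le> L * L" for n
      using kL L by (auto simp: abs_mult intro!: mult_mono)
    show "\<forall>x\<in>{a..b}. (\<lambda>n. ?q n x) \<longlonglongrightarrow> ?f x * ?f x"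
    proof
      fix x assume x: "x \<in> {a..b}"
      show "(\<lambda>n. ?q n x) \<longlonglongrightarrow> ?f x * ?f x"
      proof (cases "x \<in> N")
        case False
        then have "(\<lambda>n. k n x) \<longlonglongrightarrow> max (- L) (min L (f x))"
          unfolding k_def using g(2)[OF False] x by (intro tendsto_intros) auto
        moreover have "max (- L) (min L (f x)) = f x" using L(2)[OF x] by auto
        ultimately show ?thesis using False by (auto intro!: tendsto_intros)
      qed auto
    qed
  qed auto
  then have *: "((\<lambda>t. f t * f t) has_integral 0) {a..b}"
    by (rule has_integral_spike[OF N, rotated]) auto
  let ?g = "\<lambda>t. if t \<in> {a..b} then f t * f t else 0"
  have "(?g has_integral 0) UNIV"
    using * by (simp only: has_integral_restrict_UNIV)
  then have *: "?g \<in> borel_measurable lebesgue" "(\<integral>\<^sup>+t. ennreal (?g t) \<partial>lebesgue) = 0"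
    by (simp_all add: has_integral_iff_nn_integral_lebesgue)
  then have "AE t in lebesgue. ennreal (?g t) = 0"
    using nn_integral_0_iff_AE[of "\<lambda>t. ennreal (?g t)" lebesgue] measurable_compose[OF *(1) measurable_ennreal]
    by simp
  then have "AE t in lebesgue. t \<notin> {t \<in> {a..b}. f t \<noteq> 0}"
  proof eventually_elim
    case (elim t)
    then show ?case by (auto simp: ennreal_eq_0_iff mult_le_0_iff split: if_splits)
  qed
  then show ?thesis
    unfolding eventually_ae_filter_negligible using negligible_subset by blast
qed

text \<open>A nonnegative \<open>f\<close> makes \<open>F\<close> monotone, and
  \<open>F b \<le> F a\<close> then squeezes \<open>F\<close> to a constant. In each of the three
  optimality lemmas this turns a comparison of costs into an almost everywhere identity.\<close>

lemma nonneg_has_integral_0_imp_negligible: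
  fixes f :: "real \<Rightarrow> real"
  assumes F: "bdd_primitive a b F f" and ab: "a \<le> b"
    and "\<And>t. t \<in> {a..b} \<Longrightarrow> f t \<ge> 0" "F b \<le> F a"
  shows "negligible {t \<in> {a..b}. f t \<noteq> 0}"
proof (rule bdd_primitive_const_imp_negligible[OF F ab])
  fix t assume t: "t \<in> {a..b}"
  have "F a \<le> F t" "F t \<le> F b"
    using bdd_primitive_mono[OF F assms(3)] t by auto
  then show "F t = F a" using assms(4) by simp
qed

subsection \<open>Trajectories and expressions for the cost\<close>

text \<open>\<open>Rs_sq\<close> makes \<open>Rs\<close> the minimizer of
  \<open>\<alpha> * r + \<beta> * a / r\<close> over \<open>r > 0\<close>. Working with
  \<open>Rs\<close> avoids the square root: the singular control is \<open>a / Rs\<close>, the value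
  that holds the state at \<open>Rs\<close>.\<close>

locale control_problem =
  fixes T \<alpha> \<beta> a u1 R0 Rs :: real
  assumes T: "T > 0" and \<alpha>: "\<alpha> > 0" and \<beta>: "\<beta> > 0" and a: "a > 0" and u1: "u1 > 0"
    and R0: "R0 \<ge> 0" and Rs: "Rs > 0" and Rs_sq: "\<alpha> * Rs\<^sup>2 = a * \<beta>" and us_le: "a / Rs \<le> u1"
begin

text \<open>The control is bounded everywhere, not just almost everywhere, so that
  \<open>a - u t * R t\<close> can be bounded at every point, as \<open>bdd_primitive\<close>
  demands.\<close>

definition trajectory :: "(real \<Rightarrow> real) \<Rightarrow> (real \<Rightarrow> real) \<Rightarrow> bool" where
  "trajectory u R \<longleftrightarrow> (\<forall>t. 0 \<le> u t \<and> u t \<le> u1) \<and> u integrable_on {0..T} \<and> R 0 = R0 \<and>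
     bdd_primitive 0 T R (\<lambda>t. a - u t * R t)"

lemma trajectory_is_state:
  assumes "trajectory u R" "a = real N * \<sigma>\<^sup>2"
  shows "admissible T u1 u" "is_state T N \<sigma> R0 u R"
proof -
  have "u measurable_on {0..T}"
    using assms(1) by (simp add: trajectory_def measurable_on_iff_borel_measurable integrable_imp_measurable)
  moreover have "{t \<in> {0..T}. \<not> (0 \<le> u t \<and> u t \<le> u1)} = {}"
    using assms(1) by (auto simp: trajectory_def)
  ultimately show "admissible T u1 u"
    by (simp only: admissible_def negligible_empty)
  show "is_state T N \<sigma> R0 u R"
    unfolding is_state_def
  proof
    fix t assume "t \<in> {0..T}"
    then have "((\<lambda>s. a - u s * R s) has_integral R t - R 0) {0..t}"
      using assms(1) by (intro bdd_primitive_integral) (auto simp: trajectory_def)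
    moreover have "R 0 = R0" using assms(1) by (simp add: trajectory_def)
    ultimately show "((\<lambda>s. - u s * R s + real N * \<sigma>\<^sup>2) has_integral R t - R0) {0..t}"
      using assms(2) by simp
  qed
qed

text \<open>Clipping the control to \<open>[0, u1]\<close> changes it only on a null set, which
  affects neither the state equation nor the cost.\<close>

lemma trajectory_of_state:
  assumes adm: "admissible T u1 u" and st: "is_state T N \<sigma> R0 u R" and aeq: "a = real N * \<sigma>\<^sup>2"
  obtains v where "trajectory v R" "ae_eq_on T u v" "cost T \<alpha> \<beta> v R = cost T \<alpha> \<beta> u R"
proof -
  define v where "v = (\<lambda>t. max 0 (min u1 (u t)))"
  define Z where "Z = {t \<in> {0..T}. \<not> (0 \<le> u t \<and> u t \<le> u1)}"
  have Z: "negligible Z" using adm by (simp add: admissible_def Z_def)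
  have uv: "u t = v t" if "t \<in> {0..T} - Z" for t
    using that by (auto simp: Z_def v_def)
  have v_bounds: "0 \<le> v t" "v t \<le> u1" for t using u1 by (auto simp: v_def)
  have "u \<in> borel_measurable (lebesgue_on {0..T})"
    using adm by (simp add: admissible_def measurable_on_iff_borel_measurable)
  then have "v \<in> borel_measurable (lebesgue_on {0..T})"
    unfolding v_def by measurable
  then have vint: "v integrable_on {0..T}"
    by (rule measurable_bounded_by_integrable_imp_integrable[where g = "\<lambda>_. u1"])
       (use v_bounds in \<open>auto intro: integrable_const_ivl\<close>)
  have int: "((\<lambda>s. a - v s * R s) has_integral R t - R0) {0..t}" if t: "t \<in> {0..T}" for t
  proof (rule has_integral_spike[OF Z])
    show "((\<lambda>s. - u s * R s + real N * \<sigma>\<^sup>2) has_integral R t - R0) {0..t}"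
      using st t by (simp add: is_state_def)
    show "a - v s * R s = - u s * R s + real N * \<sigma>\<^sup>2" if "s \<in> {0..t} - Z" for s
      using uv[of s] that t aeq by auto
  qed
  have Rint: "R t = R0 + integral {0..t} (\<lambda>s. a - v s * R s)" if "t \<in> {0..T}" for t
    using integral_unique[OF int[OF that]] by simp
  have fint: "(\<lambda>s. a - v s * R s) integrable_on {0..T}"
    using int[of T] T by (auto simp: integrable_on_def)
  \<comment> \<open>The integral equation exhibits \<open>R\<close> as an indefinite integral, hence
    continuous, hence bounded; this in turn bounds the right-hand side of the equation.\<close>
  have "continuous_on {0..T} (\<lambda>t. R0 + integral {0..t} (\<lambda>s. a - v s * R s))"
    by (intro continuous_intros indefinite_integral_continuous_1 fint)
  then have "continuous_on {0..T} R"
    by (rule continuous_on_eq) (simp add: Rint)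
  then have "bounded (R ` {0..T})"
    by (simp add: compact_imp_bounded compact_continuous_image)
  then obtain B where B: "\<And>t. t \<in> {0..T} \<Longrightarrow> \<bar>R t\<bar> \<le> B"
    unfolding bounded_iff by (metis imageI real_norm_def)
  have bdd: "bounded ((\<lambda>s. a - v s * R s) ` {0..T})"
    unfolding bounded_iff
  proof (intro exI ballI, elim imageE)
    fix x s assume "x = a - v s * R s" "s \<in> {0..T}"
    moreover have "\<bar>v s * R s\<bar> \<le> u1 * B"
      using v_bounds[of s] B[OF \<open>s \<in> {0..T}\<close>] unfolding abs_mult by (intro mult_mono) auto
    ultimately show "norm x \<le> a + u1 * B" using a by auto
  qed
  have "bdd_primitive 0 T R (\<lambda>s. a - v s * R s)"
    unfolding bdd_primitive_def
  proof (intro conjI allI impI bdd)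
    fix s t assume "0 \<le> s" "s \<le> t" "t \<le> T"
    with bdd_primitive_integral[OF bdd_primitive_indefinite[OF bdd fint] this] Rint[of s] Rint[of t]
    show "((\<lambda>s. a - v s * R s) has_integral R t - R s) {s..t}" by simp
  qed
  moreover have "R 0 = R0" using Rint[of 0] T by simp
  ultimately have "trajectory v R"
    unfolding trajectory_def using v_bounds vint by auto
  moreover have "ae_eq_on T u v"
    unfolding ae_eq_on_def using uv by (intro negligible_subset[OF Z]) auto
  moreover have "cost T \<alpha> \<beta> v R = cost T \<alpha> \<beta> u R"
    unfolding cost_def using uv by (intro integral_spike[OF Z]) auto
  ultimately show thesis by (rule that)
qed

context
  fixes u R assumes traj: "trajectory u R"
begin

lemma u_bounds: "0 \<le> u t" "u t \<le> u1"
  and R_start: "R 0 = R0"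
  and R_primitive: "bdd_primitive 0 T R (\<lambda>t. a - u t * R t)"
  and u_primitive: "bdd_primitive 0 T (\<lambda>t. integral {0..t} u) u"
proof -
  show "0 \<le> u t" "u t \<le> u1" "R 0 = R0" "bdd_primitive 0 T R (\<lambda>t. a - u t * R t)" for t
    using traj by (auto simp: trajectory_def)
  have "\<And>t. 0 \<le> u t \<and> u t \<le> u1"
    using traj by (auto simp: trajectory_def)
  then have "bounded (u ` {0..T})"
    unfolding bounded_pos by (intro exI[of _ u1]) (use u1 in auto)
  then show "bdd_primitive 0 T (\<lambda>t. integral {0..t} u) u"
    using traj by (intro bdd_primitive_indefinite) (auto simp: trajectory_def)
qed

lemma R_continuous: "continuous_on {0..T} R"
  by (rule bdd_primitive_continuous_on[OF R_primitive])

section \<open>Bounds on the state\<close>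

text \<open>With the integrating factor \<open>exp (integral {0..t} u)\<close> the control cancels,
  and the derivative of the product is \<open>a\<close> times that factor, which is
  positive.\<close>

lemma R_scaled_ge:
  assumes t: "t \<in> {0..T}"
  shows "R0 \<le> R t * exp (integral {0..t} u)"
proof -
  let ?E = "\<lambda>t. exp (integral {0..t} u)"
  have E: "bdd_primitive 0 T ?E (\<lambda>t. ?E t * u t)"
    by (rule bdd_primitive_chain[OF u_primitive, of UNIV])
       (use T in \<open>auto intro!: derivative_eq_intros continuous_intros\<close>)
  have "bdd_primitive 0 T (\<lambda>t. R t * ?E t) (\<lambda>t. a * ?E t)"
    by (rule bdd_primitive_cong[OF bdd_primitive_mult[OF R_primitive E]])
       (use T in \<open>auto simp: algebra_simps\<close>)
  from bdd_primitive_mono[OF this, of 0 t] show ?thesis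
    using t a R_start by auto
qed

lemma R_nonneg: "t \<in> {0..T} \<Longrightarrow> 0 \<le> R t"
  using R_scaled_ge[of t] R0 by (metis exp_gt_zero order_trans zero_le_mult_iff not_exp_le_zero)

lemma R_pos: "t \<in> {0..T} \<Longrightarrow> 0 < R0 \<Longrightarrow> 0 < R t"
  using R_scaled_ge[of t] by (metis exp_gt_zero less_le_trans zero_less_mult_pos2)

text \<open>The control only slows the growth, since \<open>u t * R t\<close> is nonnegative; the
  slope \<open>a\<close> is reached when the control is off.\<close>

lemma R_growth:
  assumes "0 \<le> s" "s \<le> t" "t \<le> T"
  shows "R t - R s \<le> a * (t - s)"
proof -
  have "bdd_primitive 0 T (\<lambda>t. t) (\<lambda>t. 1)"
    by (rule bdd_primitive_C1) (auto intro!: derivative_eq_intros)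
  then have "bdd_primitive 0 T (\<lambda>t. a * t - R t) (\<lambda>t. a * 1 - (a - u t * R t))"
    by (intro bdd_primitive_diff R_primitive bdd_primitive_cmult)
  then have "a * s - R s \<le> a * t - R t"
    by (rule bdd_primitive_mono) (use assms u_bounds R_nonneg in auto)
  then show ?thesis by (simp add: algebra_simps)
qed

section \<open>Expressions for the cost\<close>

text \<open>A time-dependent cost is itself a primitive, so correction terms can be added to it
  under the calculus of \<open>bdd_primitive\<close>.\<close>

definition running_cost :: "real \<Rightarrow> real" where
  "running_cost t = \<alpha> * integral {0..t} R + \<beta> * integral {0..t} u"

lemma running_cost_0: "running_cost 0 = 0"
  by (simp add: running_cost_def)

lemma running_cost_T: "running_cost T = cost T \<alpha> \<beta> u R"
proof -
  have "R integrable_on {0..T}" "u integrable_on {0..T}"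
    using traj by (auto intro: integrable_continuous_real R_continuous simp: trajectory_def)
  then have "((\<lambda>t. \<alpha> * R t + \<beta> * u t) has_integral (\<alpha> * integral {0..T} R + \<beta> * integral {0..T} u)) {0..T}"
    by (intro has_integral_add has_integral_mult_right integrable_integral)
  then show ?thesis
    unfolding running_cost_def cost_def by (simp add: integral_unique)
qed

lemma running_cost_primitive: "bdd_primitive 0 T running_cost (\<lambda>t. \<alpha> * R t + \<beta> * u t)"
proof -
  have "bdd_primitive 0 T (\<lambda>t. integral {0..t} R) R"
    by (intro bdd_primitive_indefinite integrable_continuous_real R_continuous)
       (simp add: compact_imp_bounded compact_continuous_image R_continuous)
  then have "bdd_primitive 0 T (\<lambda>t. \<alpha> * integral {0..t} R + \<beta> * integral {0..t} u) (\<lambda>t. \<alpha> * R t + \<beta> * u t)"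
    by (intro bdd_primitive_add bdd_primitive_cmult u_primitive)
  then show ?thesis by (simp add: running_cost_def[abs_def])
qed

text \<open>Substituting \<open>\<beta> = \<alpha> * Rs^2 / a\<close> and subtracting the derivative
  of the square cancels all terms without \<open>u\<close>; the remaining coefficient of
  \<open>u\<close> is a perfect square.\<close>

lemma singular_primitive:
  "bdd_primitive 0 T (\<lambda>t. running_cost t - 2 * \<alpha> * Rs * t - \<alpha> / (2 * a) * (R t - 2 * Rs)\<^sup>2)
     (\<lambda>t. \<alpha> / a * (u t * (R t - Rs)\<^sup>2))"
proof -
  have const: "bdd_primitive 0 T (\<lambda>_. - 2 * Rs) (\<lambda>_. 0)" and lin: "bdd_primitive 0 T (\<lambda>t. 2 * \<alpha> * Rs * t) (\<lambda>_. 2 * \<alpha> * Rs)"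
    by (rule bdd_primitive_C1; auto intro!: derivative_eq_intros)+
  have "bdd_primitive 0 T (\<lambda>t. running_cost t - 2 * \<alpha> * Rs * t - \<alpha> / (2 * a) * (R t + - 2 * Rs)^2)
     (\<lambda>t. \<alpha> * R t + \<beta> * u t - 2 * \<alpha> * Rs - \<alpha> / (2 * a) * (of_nat 2 * (R t + - 2 * Rs)^(2-1) * (a - u t * R t + 0)))"
    using T by (intro bdd_primitive_diff bdd_primitive_cmult bdd_primitive_power bdd_primitive_add
        running_cost_primitive const lin R_primitive) auto
  then show ?thesis
  proof (rule bdd_primitive_cong)
    fix t
    have "\<beta> = \<alpha> * Rs\<^sup>2 / a" using Rs_sq a by (simp add: field_simps)
    then show "\<alpha> * R t + \<beta> * u t - 2 * \<alpha> * Rs - \<alpha> / (2 * a) * (of_nat 2 * (R t + - 2 * Rs)^(2-1) * (a - u t * R t + 0))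
      = \<alpha> / a * (u t * (R t - Rs)\<^sup>2)"
      using a by (simp add: field_simps power2_eq_square)
  qed simp
qed

text \<open>Integration by parts with the weight \<open>T - t\<close> eliminates the term
  \<open>\<alpha> * R t\<close>. The coefficient of \<open>u\<close> is the switching function
  belonging to a final arc without control, where \<open>\<alpha> * (T - t)\<close> is the adjoint
  variable.\<close>

lemma switching_primitive:
  "bdd_primitive 0 T (\<lambda>t. running_cost t + \<alpha> * ((T - t) * R t) - \<alpha> * a * (T * t - t\<^sup>2 / 2))
     (\<lambda>t. u t * (\<beta> - \<alpha> * (T - t) * R t))"
proof -
  have 1: "bdd_primitive 0 T (\<lambda>t. T - t) (\<lambda>_. -1)"
    and 2: "bdd_primitive 0 T (\<lambda>t. \<alpha> * a * (T * t - t\<^sup>2 / 2)) (\<lambda>t. \<alpha> * a * (T - t))"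
    by (rule bdd_primitive_C1; auto intro!: derivative_eq_intros continuous_intros)+
  have "bdd_primitive 0 T (\<lambda>t. running_cost t + \<alpha> * ((T - t) * R t) - \<alpha> * a * (T * t - t\<^sup>2 / 2))
    (\<lambda>t. \<alpha> * R t + \<beta> * u t + \<alpha> * (-1 * R t + (T - t) * (a - u t * R t)) - \<alpha> * a * (T - t))"
    using T by (intro bdd_primitive_diff bdd_primitive_add bdd_primitive_cmult bdd_primitive_mult
       1 2 running_cost_primitive R_primitive) auto
  then show ?thesis
    by (rule bdd_primitive_cong) (simp_all add: algebra_simps)
qed

text \<open>The state equation gives \<open>u = a / R - R' / R\<close>, and the last quotient is the
  derivative of \<open>ln R\<close>. The control disappears and the integrand depends on the state
  alone.\<close>

lemma log_primitive:
  assumes "R0 > 0"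
  shows "bdd_primitive 0 T (\<lambda>t. running_cost t + \<beta> * ln (R t)) (\<lambda>t. \<alpha> * R t + \<beta> * a / R t)"
proof -
  have ln: "bdd_primitive 0 T (\<lambda>t. ln (R t)) (\<lambda>t. 1 / R t * (a - u t * R t))"
    by (rule bdd_primitive_chain[OF R_primitive, of "{0<..}"])
       (use T R_pos assms in \<open>auto intro!: derivative_eq_intros continuous_intros\<close>)
  have "bdd_primitive 0 T (\<lambda>t. running_cost t + \<beta> * ln (R t))
     (\<lambda>t. \<alpha> * R t + \<beta> * u t + \<beta> * (1 / R t * (a - u t * R t)))"
    by (intro bdd_primitive_add bdd_primitive_cmult running_cost_primitive ln)
  then show ?thesis
  proof (rule bdd_primitive_cong)
    fix t assume "t \<in> {0..T}"
    then show "\<alpha> * R t + \<beta> * u t + \<beta> * (1 / R t * (a - u t * R t)) = \<alpha> * R t + \<beta> * a / R t"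
      using R_pos[of t] assms by (simp add: field_simps)
  qed simp
qed

text \<open>The left side is the state under constant control \<open>u1\<close>, which is thus the
  lowest reachable one: \<open>(R t - a / u1) * exp (u1 * t)\<close> has the nonnegative derivative
  \<open>exp (u1 * t) * (u1 - u t) * R t\<close>.\<close>

lemma R_ge_full_control:
  assumes t: "t \<in> {0..T}"
  shows "a / u1 + (R0 - a / u1) * exp (- u1 * t) \<le> R t"
proof -
  have E: "bdd_primitive 0 T (\<lambda>t. exp (u1 * t)) (\<lambda>t. exp (u1 * t) * u1)"
    and c: "bdd_primitive 0 T (\<lambda>t. a / u1) (\<lambda>t. 0)"
    by (rule bdd_primitive_C1; auto intro!: derivative_eq_intros continuous_intros)+
  have "bdd_primitive 0 T (\<lambda>t. (R t - a / u1) * exp (u1 * t))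
      (\<lambda>t. (a - u t * R t - 0) * exp (u1 * t) + (R t - a / u1) * (exp (u1 * t) * u1))"
    using T by (intro bdd_primitive_mult bdd_primitive_diff R_primitive E c) auto
  then have "bdd_primitive 0 T (\<lambda>t. (R t - a / u1) * exp (u1 * t)) (\<lambda>t. exp (u1 * t) * ((u1 - u t) * R t))"
    by (rule bdd_primitive_cong) (use u1 in \<open>simp_all add: field_simps\<close>)
  from bdd_primitive_mono[OF this, of 0 t] have "R0 - a / u1 \<le> (R t - a / u1) * exp (u1 * t)"
    using t u_bounds R_nonneg R_start by auto
  then show ?thesis by (simp add: exp_minus field_simps)
qed

end

subsection \<open>Optimal trajectories\<close>

text \<open>One construction for the candidates with switchings: an arc \<open>\<rho>\<close> under
  constant control \<open>w\<close>, a stay at \<open>Rs\<close>, then free growth with slope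
  \<open>a\<close>. The \<open>min\<close> freezes \<open>\<rho>\<close> at \<open>t1\<close> and
  the \<open>max\<close> starts the growth at \<open>t2\<close>; for \<open>t1 = t2\<close> the
  singular arc is empty.\<close>

lemma candidate_trajectory:
  assumes w: "0 \<le> w" "w \<le> u1"
    and \<rho>: "\<And>t. (\<rho> has_real_derivative a - w * \<rho> t) (at t)" "\<rho> 0 = R0"
    and t12: "0 \<le> t1" "t1 \<le> t2" "t2 \<le> T" "t1 < t2 \<Longrightarrow> \<rho> t1 = Rs"
  shows "trajectory (\<lambda>t. if t < t1 then w else if t < t2 then a / Rs else 0)
           (\<lambda>t. \<rho> (min t t1) + a * max 0 (t - t2))"
proof -
  let ?v = "\<lambda>t. if t < t1 then w else if t < t2 then a / Rs else 0"
  let ?S = "\<lambda>t. \<rho> (min t t1) + a * max 0 (t - t2)"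
  have v_bounds: "0 \<le> ?v t" "?v t \<le> u1" for t
    using w us_le divide_pos_pos[OF a Rs] u1 by (simp_all add: less_imp_le)
  have "?v \<in> borel_measurable borel" by measurable
  then have "?v \<in> borel_measurable (lebesgue_on {0..T})"
    by (intro measurable_restrict_space1 measurable_completion) simp
  then have vint: "?v integrable_on {0..T}"
    by (rule measurable_bounded_by_integrable_imp_integrable[where g = "\<lambda>_. u1"])
       (use v_bounds in \<open>auto intro: integrable_const_ivl\<close>)
  have "continuous_on UNIV \<rho>"
    by (intro continuous_at_imp_continuous_on ballI DERIV_isCont[OF \<rho>(1)])
  then have "continuous_on {0..T} (\<lambda>t. \<rho> (min t t1))"
    by (rule continuous_on_compose2) (auto intro!: continuous_intros)
  then have contS: "continuous_on {0..T} ?S"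
    by (intro continuous_intros)
  then have "bounded (?S ` {0..T})"
    by (simp add: compact_imp_bounded compact_continuous_image)
  then obtain B where B: "\<And>t. t \<in> {0..T} \<Longrightarrow> \<bar>?S t\<bar> \<le> B"
    unfolding bounded_iff by (metis (no_types, lifting) imageI real_norm_def)
  have "bdd_primitive 0 T ?S (\<lambda>t. a - ?v t * ?S t)"
  proof (rule bdd_primitive_piecewise[of "{t1, t2}"])
    show "bounded ((\<lambda>t. a - ?v t * ?S t) ` {0..T})"
      unfolding bounded_iff
    proof (intro exI ballI, elim imageE)
      fix x s assume "x = a - ?v s * ?S s" "s \<in> {0..T}"
      moreover have "\<bar>?v s * ?S s\<bar> \<le> u1 * B"
        using v_bounds[of s] B[OF \<open>s \<in> {0..T}\<close>] u1 unfolding abs_mult by (intro mult_mono) auto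
      ultimately show "norm x \<le> a + u1 * B" using a by (simp add: abs_le_iff)
    qed
    fix x assume x: "x \<in> {0<..<T} - {t1, t2}"
    then consider "x < t1" | "t1 < x" "x < t2" | "t2 < x" by force
    then show "(?S has_real_derivative a - ?v x * ?S x) (at x)"
    proof cases
      case 1
      then have S: "?S x = \<rho> x" using t12 by simp
      have "(\<rho> has_real_derivative a - ?v x * ?S x) (at x)"
        unfolding S using \<rho>(1)[of x] 1 by simp
      then show ?thesis
        by (rule has_field_derivative_transform_within_open[of _ _ _ "{..<t1}"]) (use 1 t12 in auto)
    next
      case 2
      then have S: "?S x = Rs" using t12 by simp
      have "((\<lambda>_. Rs) has_real_derivative a - ?v x * ?S x) (at x)"
        unfolding S using 2 Rs by simp
      then show ?thesis
        by (rule has_field_derivative_transform_within_open[of _ _ _ "{t1<..<t2}"]) (use 2 t12 in auto)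
    next
      case 3
      have "((\<lambda>t. \<rho> t1 + a * (t - t2)) has_real_derivative a - ?v x * ?S x) (at x)"
        using 3 t12 by (auto intro!: derivative_eq_intros)
      then show ?thesis
        by (rule has_field_derivative_transform_within_open[of _ _ _ "{t2<..}"]) (use 3 t12 in auto)
    qed
  qed (use contS in auto)
  then show ?thesis
    unfolding trajectory_def using v_bounds vint t12 \<rho>(2) by auto
qed

text \<open>Continuity upgrades almost everywhere equality of the states to equality. Their
  derivatives then agree almost everywhere, and dividing by the positive state recovers the
  control.\<close>

lemma same_state_imp_same_control:
  assumes u: "trajectory u R" and v: "trajectory v S" and "R0 > 0"
    and ae: "negligible {t \<in> {0..T}. R t \<noteq> S t}"
  shows "ae_eq_on T u v"
proof -
  have cont: "continuous_on {0..T} (\<lambda>t. \<bar>R t - S t\<bar>)"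
    by (intro continuous_intros R_continuous[OF u] R_continuous[OF v])
  have "((\<lambda>t. \<bar>R t - S t\<bar>) has_integral 0) {0..T}"
    by (rule has_integral_spike[OF ae, of _ _ "\<lambda>_. 0"]) auto
  then have "\<bar>R t - S t\<bar> = 0" if "t \<in> {0..T}" for t
    using has_integral_0_cbox_imp_0[of 0 T "\<lambda>t. \<bar>R t - S t\<bar>" t] that cont T by simp
  then have eq: "R t = S t" if "t \<in> {0..T}" for t
    using that by simp
  have "negligible {t \<in> {0..T}. (a - u t * R t) - (a - v t * S t) \<noteq> 0}"
    by (rule bdd_primitive_const_imp_negligible[OF
          bdd_primitive_diff[OF R_primitive[OF u] R_primitive[OF v]]])
       (use eq T in auto)
  then show ?thesis
    unfolding ae_eq_on_def
    by (rule negligible_subset) (use eq R_pos[OF u] \<open>R0 > 0\<close> in force)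
qed

section \<open>Uniqueness of the optimal control in the three regimes\<close>

text \<open>Every state lies below \<open>R0 + a * t\<close>, so the assumptions make the switching
  function nonnegative on any trajectory and positive away from \<open>t0\<close>. The instant
  \<open>t0\<close> admits the borderline case in which the bound touches \<open>\<beta>\<close>
  once.\<close>

lemma optimal_zero:
  assumes u: "trajectory u R"
    and opt: "\<And>v S. trajectory v S \<Longrightarrow> cost T \<alpha> \<beta> u R \<le> cost T \<alpha> \<beta> v S"
    and strict: "\<And>t. t \<in> {0..T} \<Longrightarrow> t \<noteq> t0 \<Longrightarrow> \<alpha> * (T - t) * (R0 + a * t) < \<beta>"
    and weak: "\<alpha> * (T - t0) * (R0 + a * t0) \<le> \<beta>"
  shows "ae_eq_on T u (\<lambda>t. 0)"
proof -
  let ?S = "\<lambda>t. R0 + a * t"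
  have S: "trajectory (\<lambda>_. 0) ?S"
    unfolding trajectory_def
  proof (intro conjI allI)
    show "bdd_primitive 0 T ?S (\<lambda>t. a - 0 * ?S t)"
      by (rule bdd_primitive_C1) (auto intro!: derivative_eq_intros)
  qed (use u1 in auto)
  have "((\<lambda>t. 0 * (\<beta> - \<alpha> * (T - t) * ?S t)) has_integral
      (cost T \<alpha> \<beta> (\<lambda>_. 0) ?S - \<alpha> * a * (T * T - T\<^sup>2 / 2)) - \<alpha> * (T * R0)) {0..T}"
    using bdd_primitive_integral[OF switching_primitive[OF S], of 0 T] T
      running_cost_0[OF S] running_cost_T[OF S] by simp
  \<comment> \<open>For the zero control the integrand of the switching identity vanishes, so the
    cost can be read off from the boundary terms.\<close>
  then have costS: "cost T \<alpha> \<beta> (\<lambda>_. 0) ?S = \<alpha> * a * (T * T - T\<^sup>2 / 2) + \<alpha> * (T * R0)"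
    by (simp add: has_integral_0_eq)
  have R_le: "R t \<le> ?S t" if "t \<in> {0..T}" for t
    using R_growth[OF u, of 0 t] R_start[OF u] that by simp
  have le: "\<alpha> * (T - t) * R t \<le> \<alpha> * (T - t) * ?S t" if "t \<in> {0..T}" for t
    using R_le[OF that] that \<alpha> by (intro mult_left_mono) auto
  have weak': "\<alpha> * (T - t) * ?S t \<le> \<beta>" if "t \<in> {0..T}" for t
    using strict[OF that] weak by (cases "t = t0") auto
  have "negligible {t \<in> {0..T}. u t * (\<beta> - \<alpha> * (T - t) * R t) \<noteq> 0}"
  proof (rule nonneg_has_integral_0_imp_negligible[OF switching_primitive[OF u]])
    show "0 \<le> u t * (\<beta> - \<alpha> * (T - t) * R t)" if "t \<in> {0..T}" for t
      using le[OF that] weak'[OF that] u_bounds[OF u, of t] by (intro mult_nonneg_nonneg) auto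
    show "running_cost u R T + \<alpha> * ((T - T) * R T) - \<alpha> * a * (T * T - T\<^sup>2 / 2)
        \<le> running_cost u R 0 + \<alpha> * ((T - 0) * R 0) - \<alpha> * a * (T * 0 - 0\<^sup>2 / 2)"
      using opt[OF S] costS running_cost_0[OF u] running_cost_T[OF u] R_start[OF u] by simp
  qed (use T in auto)
  then have "negligible (insert t0 {t \<in> {0..T}. u t * (\<beta> - \<alpha> * (T - t) * R t) \<noteq> 0})"
    by simp
  then show ?thesis
    unfolding ae_eq_on_def
  proof (rule negligible_subset)
    show "{t \<in> {0..T}. u t \<noteq> 0} \<subseteq> insert t0 {t \<in> {0..T}. u t * (\<beta> - \<alpha> * (T - t) * R t) \<noteq> 0}"
    proof (rule subsetI, rule ccontr)
      fix t assume t: "t \<in> {t \<in> {0..T}. u t \<noteq> 0}"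
        and n: "t \<notin> insert t0 {t \<in> {0..T}. u t * (\<beta> - \<alpha> * (T - t) * R t) \<noteq> 0}"
      then have "\<alpha> * (T - t) * R t = \<beta>" by simp
      then show False using le[of t] strict[of t] t n by simp
    qed
  qed
qed

text \<open>The candidate reaches \<open>Rs\<close> as early as possible and leaves it just in time
  to end at \<open>2 * Rs\<close>. An equally cheap trajectory also ends there and has
  \<open>u = 0\<close> or \<open>R = Rs\<close> almost everywhere; the growth bound keeps it off
  \<open>Rs\<close> before \<open>t1\<close> and after \<open>t2\<close>, which fixes it on the
  outer arcs.\<close>

lemma optimal_singular:
  assumes u: "trajectory u R"
    and opt: "\<And>v S. trajectory v S \<Longrightarrow> cost T \<alpha> \<beta> u R \<le> cost T \<alpha> \<beta> v S"
    and R0_le: "R0 \<le> Rs" and long: "2 * Rs < R0 + a * T"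
  defines "t1 \<equiv> (Rs - R0) / a" and "t2 \<equiv> T - Rs / a"
  shows "ae_eq_on T u (\<lambda>t. if t < t1 then 0 else if t < t2 then a / Rs else 0)"
proof -
  let ?v = "\<lambda>t. if t < t1 then 0 else if t < t2 then a / Rs else 0"
  let ?S = "\<lambda>t. (R0 + a * min t t1) + a * max 0 (t - t2)"
  have "t2 - t1 = (R0 + a * T - 2 * Rs) / a"
    using a by (simp add: t1_def t2_def field_simps)
  then have "t2 - t1 > 0" using long a by simp
  then have t12: "0 \<le> t1" "t1 < t2" "t2 < T"
    using R0_le a Rs by (auto simp: t1_def t2_def)
  have at1: "R0 + a * t1 = Rs" and at2: "a * (T - t2) = Rs"
    using a by (auto simp: t1_def t2_def)
  have S: "trajectory ?v ?S"
    by (rule candidate_trajectory[of 0 "\<lambda>t. R0 + a * t" t1 t2])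
       (use t12 at1 u1 in \<open>auto intro!: derivative_eq_intros\<close>)
  have zero: "\<alpha> / a * (?v t * (?S t - Rs)\<^sup>2) = 0" for t
    using t12 at1 by auto
  have S_ends: "?S 0 = R0" "?S T = 2 * Rs"
    using t12 at1 at2 by auto
  have "((\<lambda>t. 0) has_integral
      (cost T \<alpha> \<beta> ?v ?S - 2 * \<alpha> * Rs * T - \<alpha> / (2 * a) * (2 * Rs - 2 * Rs)\<^sup>2)
      - (0 - 2 * \<alpha> * Rs * 0 - \<alpha> / (2 * a) * (R0 - 2 * Rs)\<^sup>2)) {0..T}"
    using bdd_primitive_integral[OF singular_primitive[OF S] order_refl less_imp_le[OF T] order_refl]
    unfolding zero S_ends running_cost_0[OF S] running_cost_T[OF S] .
  then have costS: "cost T \<alpha> \<beta> ?v ?S = 2 * \<alpha> * Rs * T - \<alpha> / (2 * a) * (R0 - 2 * Rs)\<^sup>2"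
    unfolding has_integral_0_eq by simp
  have nonneg: "0 \<le> \<alpha> / a * (u t * (R t - Rs)\<^sup>2)" for t
    using \<alpha> a u_bounds[OF u, of t] by simp
  note cost_le = opt[OF S, unfolded costS]
  have "- \<alpha> / (2 * a) * (R0 - 2 * Rs)\<^sup>2 \<le> cost T \<alpha> \<beta> u R - 2 * \<alpha> * Rs * T - \<alpha> / (2 * a) * (R T - 2 * Rs)\<^sup>2"
    using bdd_primitive_mono[OF singular_primitive[OF u] nonneg, of 0 T] T
      running_cost_0[OF u] running_cost_T[OF u] R_start[OF u] by simp
  then have "\<alpha> / (2 * a) * (R T - 2 * Rs)\<^sup>2 \<le> 0"
    using cost_le by simp
  then have RT: "R T = 2 * Rs"
    using \<alpha> a by (auto simp: mult_le_0_iff divide_le_0_iff)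
  define Z where "Z = {t \<in> {0..T}. \<alpha> / a * (u t * (R t - Rs)\<^sup>2) \<noteq> 0}"
  have Z: "negligible Z"
    unfolding Z_def
  proof (rule nonneg_has_integral_0_imp_negligible[OF singular_primitive[OF u] _ nonneg])
    show "running_cost u R T - 2 * \<alpha> * Rs * T - \<alpha> / (2 * a) * (R T - 2 * Rs)\<^sup>2
      \<le> running_cost u R 0 - 2 * \<alpha> * Rs * 0 - \<alpha> / (2 * a) * (R 0 - 2 * Rs)\<^sup>2"
      using cost_le running_cost_0[OF u] running_cost_T[OF u] R_start[OF u] RT by simp
  qed (use T in auto)
  have off_Z: "u t = 0 \<or> R t = Rs" if "t \<in> {0..T} - Z" for t
    using that \<alpha> a by (auto simp: Z_def)
  have before: "R t < Rs" if "0 \<le> t" "t < t1" for t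
  proof -
    have "R t \<le> R0 + a * t" using R_growth[OF u, of 0 t] R_start[OF u] that t12 by simp
    also have "\<dots> < Rs" using that a unfolding at1[symmetric] by simp
    finally show ?thesis .
  qed
  have after: "R t > Rs" if "t2 < t" "t \<le> T" for t
  proof -
    have "a * (T - t) < a * (T - t2)" using that a by simp
    then show ?thesis using R_growth[OF u, of t T] RT that t12 at2 by simp
  qed
  \<comment> \<open>Away from \<open>Rs\<close> the control is off almost everywhere. The endpoints
    join the exceptional set because the state may equal \<open>Rs\<close> there.\<close>
  have free: "R t - R s = a * (t - s)"
    if st: "0 \<le> s" "s \<le> t" "t \<le> T" "\<And>r. r \<in> {s<..<t} \<Longrightarrow> R r \<noteq> Rs" for s t
  proof -
    have "((\<lambda>r. a - u r * R r) has_integral a * (t - s)) {s..t}"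
    proof (rule has_integral_spike[of "Z \<union> {s, t}"])
      show "((\<lambda>_. a) has_integral a * (t - s)) {s..t}"
        using has_integral_const_real[of a s t] st by (simp add: mult.commute)
      show "a - u r * R r = a" if "r \<in> {s..t} - (Z \<union> {s, t})" for r
        using off_Z[of r] st that by auto
    qed (use Z in auto)
    with bdd_primitive_integral[OF R_primitive[OF u] st(1-3)] show ?thesis
      by (rule has_integral_unique)
  qed
  have "R r \<noteq> Rs" if "r \<in> {0<..<t1}" for r
    using before[of r] that by simp
  then have "R t1 - R 0 = a * (t1 - 0)"
    using t12 by (intro free) auto
  then have Rt1: "R t1 = Rs" using R_start[OF u] at1 by simp
  have "R r \<noteq> Rs" if "r \<in> {t2<..<T}" for r
    using after[of r] that by simp
  then have "R T - R t2 = a * (T - t2)"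
    using t12 by (intro free) auto
  then have Rt2: "R t2 = Rs" using RT at2 by simp
  have mid_prim: "bdd_primitive t1 t2 R (\<lambda>t. a - u t * R t)"
    using bdd_primitive_subinterval[OF R_primitive[OF u]] t12 by simp
  \<comment> \<open>Where \<open>u (R - R\<^sub>s)\<^sup>2 = 0\<close>, the derivative of \<open>(R - R\<^sub>s)\<^sup>3\<close> is \<open>3 a (R - R\<^sub>s)\<^sup>2\<close>, free of \<open>u\<close>.\<close>
  have "bdd_primitive t1 t2 (\<lambda>t. (R t - Rs)^3) (\<lambda>t. of_nat 3 * (R t - Rs)^(3-1) * (a - u t * R t - 0))"
  proof (intro bdd_primitive_power bdd_primitive_diff mid_prim)
    show "bdd_primitive t1 t2 (\<lambda>_. Rs) (\<lambda>_. 0)"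
      by (rule bdd_primitive_C1) auto
  qed (use t12 in auto)
  from bdd_primitive_integral[OF this, of t1 t2]
  have "((\<lambda>t. 3 * (R t - Rs)\<^sup>2 * (a - u t * R t)) has_integral 0) {t1..t2}"
    using t12 Rt1 Rt2 by simp
  then have int0: "((\<lambda>t. 3 * (R t - Rs)\<^sup>2 * a) has_integral 0) {t1..t2}"
  proof (rule has_integral_spike[OF Z, rotated])
    fix t assume "t \<in> {t1..t2} - Z"
    then show "3 * (R t - Rs)\<^sup>2 * a = 3 * (R t - Rs)\<^sup>2 * (a - u t * R t)"
      using off_Z[of t] t12 by auto
  qed
  have "continuous_on {t1..t2} (\<lambda>t. 3 * (R t - Rs)\<^sup>2 * a)"
    by (intro continuous_intros continuous_on_subset[OF R_continuous[OF u]]) (use t12 in auto)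
  then have "3 * (R t - Rs)\<^sup>2 * a = 0" if "t \<in> {t1..t2}" for t
    using has_integral_0_cbox_imp_0[of t1 t2 "\<lambda>t. 3 * (R t - Rs)\<^sup>2 * a" t] int0 that t12 a by simp
  then have mid: "R t = Rs" if "t \<in> {t1..t2}" for t
    using that a by simp
  \<comment> \<open>A constant state on the middle arc forces \<open>u t * Rs = a\<close> almost
    everywhere there.\<close>
  have M: "negligible {t \<in> {t1..t2}. a - u t * R t \<noteq> 0}"
    by (rule bdd_primitive_const_imp_negligible[OF mid_prim]) (use mid t12 in auto)
  \<comment> \<open>The point \<open>t2\<close> is added because the state equals \<open>Rs\<close>
    there while the candidate control is already zero.\<close>
  have "negligible (Z \<union> {t \<in> {t1..t2}. a - u t * R t \<noteq> 0} \<union> {t2})"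
    using Z M by simp
  then show ?thesis
    unfolding ae_eq_on_def
  proof (rule negligible_subset)
    show "{t \<in> {0..T}. u t \<noteq> ?v t} \<subseteq> Z \<union> {t \<in> {t1..t2}. a - u t * R t \<noteq> 0} \<union> {t2}"
    proof (rule subsetI, rule ccontr)
      fix t assume t: "t \<in> {t \<in> {0..T}. u t \<noteq> ?v t}"
        and n: "t \<notin> Z \<union> {t \<in> {t1..t2}. a - u t * R t \<noteq> 0} \<union> {t2}"
      then consider "t < t1" | "t1 \<le> t" "t < t2" | "t2 < t" by force
      then show False
      proof cases
        case 1
        then show False using t n before[of t] off_Z[of t] by auto
      next
        case 2
        then have "u t * Rs = a" using n mid[of t] by auto
        then show False using t 2 Rs by (auto simp: field_simps)
      next
        case 3
        then show False using t n after[of t] off_Z[of t] t12 by auto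
      qed
    qed
  qed
qed

text \<open>The logarithmic expression is compared with its tangents at the candidate, both under
  the integral and at time \<open>T\<close>. \<open>switch\<close> says that the switching function
  vanishes when the last arc begins, the state being \<open>\<rho> t1\<close> at
  \<open>t2\<close>.\<close>

lemma optimal_full_start:
  assumes u: "trajectory u R"
    and opt: "\<And>v S. trajectory v S \<Longrightarrow> cost T \<alpha> \<beta> u R \<le> cost T \<alpha> \<beta> v S"
    and R0_gt: "Rs < R0"
  defines "\<rho> \<equiv> \<lambda>t. a / u1 + (R0 - a / u1) * exp (- u1 * t)"
  assumes t12: "0 < t1" "t1 \<le> t2" "t2 < T" "t1 < t2 \<Longrightarrow> \<rho> t1 = Rs"
    and r_ge: "Rs \<le> \<rho> t1" and switch: "\<alpha> * (T - t2) * \<rho> t1 = \<beta>"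
  shows "ae_eq_on T u (\<lambda>t. if t < t1 then u1 else if t < t2 then a / Rs else 0)"
proof -
  let ?v = "\<lambda>t. if t < t1 then u1 else if t < t2 then a / Rs else 0"
  define r where "r = \<rho> t1"
  define S where "S = (\<lambda>t. \<rho> (min t t1) + a * max 0 (t - t2))"
  have r_pos: "r > 0" using r_ge Rs by (simp add: r_def)
  have R0_pos: "R0 > 0" using R0_gt Rs by simp
  have S: "trajectory ?v S"
    unfolding S_def
    by (rule candidate_trajectory)
       (use t12 u1 in \<open>auto simp: \<rho>_def intro!: derivative_eq_intros simp: field_simps\<close>)
  have S0: "S 0 = R0" using t12 by (simp add: S_def \<rho>_def)
  have S_early: "S t = \<rho> t" if "t \<le> t1" for t using that t12 by (simp add: S_def)
  have S_mid: "S t = Rs" if "t1 < t" "t \<le> t2" for t using that t12 by (simp add: S_def)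
  have S_late: "S t = r + a * (t - t2)" if "t2 \<le> t" for t using that t12 by (simp add: S_def r_def)
  have "a / u1 \<le> Rs" using us_le Rs u1 by (simp add: field_simps)
  then have "R0 - a / u1 \<ge> 0" using R0_gt by simp
  then have \<rho>_antimono: "\<rho> t \<le> \<rho> s" if "s \<le> t" for s t
    using that u1 by (auto simp: \<rho>_def intro!: mult_left_mono)
  have S_ge: "Rs \<le> S t" if "t \<in> {0..T}" for t
  proof -
    have "Rs \<le> \<rho> (min t t1)" using \<rho>_antimono[of "min t t1" t1] r_ge by simp
    then show ?thesis using a by (simp add: S_def add_increasing2)
  qed
  have S_pos: "S t > 0" if "t \<in> {0..T}" for t using S_ge[OF that] Rs by simp
  note R_pos = R_pos[OF u _ R0_pos]
  define \<delta> where "\<delta> = R T - S T"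
  \<comment> \<open>\<open>c\<close> is the slope of \<open>\<alpha> r + \<beta> a / r\<close> at the candidate on the last arc. As \<open>R - S\<close> decreases there, \<open>R - S\<close>
    may be replaced by its final value \<open>\<delta>\<close>, and the switching condition at \<open>t2\<close> makes \<open>\<delta> \<integral> c\<close> cancel the
    tangent bound for the terminal cost \<open>- \<beta> ln R(T)\<close>.\<close>
  define c where "c = (\<lambda>t. if t2 < t then \<alpha> - \<beta> * a / (S t)\<^sup>2 else 0)"
  \<comment> \<open>On the last arc the candidate has slope \<open>a\<close>, so
    \<open>(\<alpha> * S + \<beta> * a / S) / a\<close> is an antiderivative of \<open>c\<close>;
    the \<open>max\<close> makes it constant before \<open>t2\<close>.\<close>
  define \<Gamma> where "\<Gamma> = (\<lambda>t. (\<alpha> * (r + a * max 0 (t - t2)) + \<beta> * a / (r + a * max 0 (t - t2))) / a)"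
  have slope: "0 \<le> \<alpha> - \<beta> * a / s\<^sup>2" "\<alpha> - \<beta> * a / s\<^sup>2 \<le> \<alpha>" if "Rs \<le> s" for s
  proof -
    have "\<alpha> * Rs\<^sup>2 \<le> \<alpha> * s\<^sup>2" using that Rs \<alpha> by (intro mult_left_mono power_mono) auto
    then show "0 \<le> \<alpha> - \<beta> * a / s\<^sup>2" using that Rs Rs_sq by (simp add: field_simps)
    show "\<alpha> - \<beta> * a / s\<^sup>2 \<le> \<alpha>" using a \<beta> by simp
  qed
  have \<Gamma>_prim: "bdd_primitive 0 T \<Gamma> c"
  proof (rule bdd_primitive_piecewise[of "{t2}"])
    have "r + a * max 0 (t - t2) \<noteq> 0" for t
      using r_pos a by (smt (verit) mult_nonneg_nonneg)
    then show "continuous_on {0..T} \<Gamma>"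
      unfolding \<Gamma>_def using a by (intro continuous_intros) auto
    have "\<bar>c t\<bar> \<le> \<alpha>" if "t \<in> {0..T}" for t
      using slope[OF S_ge[OF that]] \<alpha> by (auto simp: c_def)
    then show "bounded (c ` {0..T})" unfolding bounded_iff by (intro exI[of _ \<alpha>]) simp
    fix x assume x: "x \<in> {0<..<T} - {t2}"
    then consider "x < t2" | "t2 < x" by force
    then show "(\<Gamma> has_real_derivative c x) (at x)"
    proof cases
      case 1
      have "((\<lambda>t. (\<alpha> * r + \<beta> * a / r) / a) has_real_derivative c x) (at x)"
        using 1 by (simp add: c_def)
      then show ?thesis
        by (rule has_field_derivative_transform_within_open[of _ _ _ "{..<t2}"]) (use 1 in \<open>auto simp: \<Gamma>_def\<close>)
    next
      case 2
      have pos: "r + a * (x - t2) > 0" using 2 r_pos a by (simp add: add_pos_pos)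
      have cx: "c x = \<alpha> - \<beta> * a / (r + a * (x - t2))\<^sup>2"
        using 2 S_late[of x] by (simp add: c_def)
      have "((\<lambda>t. (\<alpha> * (r + a * (t - t2)) + \<beta> * a / (r + a * (t - t2))) / a) has_real_derivative
         (\<alpha> * a + (- (\<beta> * a * a) / (r + a * (x - t2))\<^sup>2)) / a) (at x)"
        using pos a by (auto intro!: derivative_eq_intros simp: power2_eq_square)
      also have "(\<alpha> * a + (- (\<beta> * a * a) / (r + a * (x - t2))\<^sup>2)) / a = c x"
        unfolding cx using a by (simp add: diff_divide_distrib)
      finally show ?thesis
        by (rule has_field_derivative_transform_within_open[of _ _ _ "{t2<..}"]) (use 2 in \<open>auto simp: \<Gamma>_def\<close>)
    qed
  qed auto
  have ST: "S T = r + a * (T - t2)" using S_late t12 by simp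
  \<comment> \<open>The result is the slope of \<open>\<beta> * ln\<close> at \<open>S T\<close>, as
    required for the cancellation with the terminal term.\<close>
  have \<Gamma>_diff: "\<Gamma> T - \<Gamma> 0 = \<beta> / S T"
  proof -
    have "\<Gamma> T = (\<alpha> * S T + \<beta> * a / S T) / a" "\<Gamma> 0 = (\<alpha> * r + \<beta> * a / r) / a"
      using t12 ST by (simp_all add: \<Gamma>_def)
    then have "\<Gamma> T - \<Gamma> 0 = (\<alpha> * (S T - r) + \<beta> * a / S T - \<beta> * a / r) / a"
      by (simp add: right_diff_distrib diff_divide_distrib add_divide_distrib)
    also have "\<alpha> * (S T - r) = a * (\<alpha> * (T - t2))" using ST by simp
    also have "\<alpha> * (T - t2) = \<beta> / r" using switch r_pos by (simp add: r_def field_simps)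
    finally show ?thesis using a by simp
  qed
  let ?e = "\<lambda>t. (\<alpha> * R t + \<beta> * a / R t) - (\<alpha> * S t + \<beta> * a / S t) - \<delta> * c t"
  have gap: "?e t \<ge> 0 \<and> (?e t = 0 \<longrightarrow> R t = S t)" if t: "t \<in> {0..T}" for t
  proof -
    have pos: "R t > 0" "S t > 0" using R_pos S_pos t by auto
    \<comment> \<open>Exact expansion of \<open>\<alpha> * r + \<beta> * a / r\<close> around
      \<open>S t\<close>: the tangent term plus a remainder that vanishes only at
      \<open>R t = S t\<close>.\<close>
    have convex: "(\<alpha> * R t + \<beta> * a / R t) - (\<alpha> * S t + \<beta> * a / S t)
        = (\<alpha> - \<beta> * a / (S t)\<^sup>2) * (R t - S t) + \<beta> * a * (R t - S t)\<^sup>2 / (R t * (S t)\<^sup>2)"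
      using pos by (simp add: field_simps power2_eq_square)
    have mono: "(\<alpha> - \<beta> * a / (S t)\<^sup>2) * (R t - S t) - \<delta> * c t \<ge> 0"
    proof -
      \<comment> \<open>On the first arc the candidate is the lowest state and the slope is
        nonnegative; on the singular arc the slope is zero; on the last arc \<open>R - S\<close> is
        nonincreasing, hence at least its final value \<open>\<delta>\<close>, whatever its
        sign.\<close>
      consider "t \<le> t1" | "t1 < t" "t \<le> t2" | "t2 < t" by force
      then show ?thesis
      proof cases
        case 1
        then have "S t \<le> R t"
          using R_ge_full_control[OF u t] S_early[of t] by (simp add: \<rho>_def)
        then show ?thesis using slope[OF S_ge[OF t]] 1 t12 by (simp add: c_def)
      next
        case 2
        have "\<alpha> - \<beta> * a / (S t)\<^sup>2 = 0"
          using S_mid[OF 2] Rs Rs_sq by (simp add: field_simps)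
        then show ?thesis using 2 by (simp add: c_def)
      next
        case 3
        have "S T - S t = a * (T - t)"
          using 3 S_late[of t] ST by (simp add: algebra_simps)
        then have "0 \<le> R t - S t - \<delta>"
          using R_growth[OF u, of t T] t by (simp add: \<delta>_def)
        then have "0 \<le> (\<alpha> - \<beta> * a / (S t)\<^sup>2) * (R t - S t - \<delta>)"
          using slope[OF S_ge[OF t]] by simp
        moreover have "k * (x - \<delta>) = k * x - \<delta> * k" for k x
          by (simp add: algebra_simps)
        ultimately show ?thesis using 3 by (simp only: c_def if_True)
      qed
    qed
    have quad: "\<beta> * a * (R t - S t)\<^sup>2 / (R t * (S t)\<^sup>2) \<ge> 0"
      using pos \<beta> a by simp
    have "R t = S t" if "\<beta> * a * (R t - S t)\<^sup>2 / (R t * (S t)\<^sup>2) = 0"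
      using that pos \<beta> a by simp
    then show ?thesis using convex mono quad by linarith
  qed
  have prim: "bdd_primitive 0 T
     (\<lambda>t. (running_cost u R t + \<beta> * ln (R t)) - (running_cost ?v S t + \<beta> * ln (S t)) - \<delta> * \<Gamma> t) ?e"
    by (intro bdd_primitive_diff bdd_primitive_cmult log_primitive u S R0_pos \<Gamma>_prim)
  have "negligible {t \<in> {0..T}. ?e t \<noteq> 0}"
  proof (rule nonneg_has_integral_0_imp_negligible[OF prim])
    have "R T / S T > 0" using R_pos[of T] S_pos[of T] T by simp
    then have "ln (R T / S T) \<le> R T / S T - 1" by (rule ln_le_minus_one)
    also have "R T / S T - 1 = \<delta> / S T" using S_pos[of T] T by (simp add: \<delta>_def field_simps)
    finally have "ln (R T) - ln (S T) \<le> \<delta> / S T"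
      using R_pos[of T] S_pos[of T] T by (simp add: ln_div)
    then have "\<beta> * (ln (R T) - ln (S T)) \<le> \<beta> * (\<delta> / S T)"
      using \<beta> by (intro mult_left_mono) auto
    also have "\<dots> = \<delta> * \<Gamma> T - \<delta> * \<Gamma> 0"
      using \<Gamma>_diff by (simp flip: right_diff_distrib)
    finally show "(running_cost u R T + \<beta> * ln (R T)) - (running_cost ?v S T + \<beta> * ln (S T)) - \<delta> * \<Gamma> T
      \<le> (running_cost u R 0 + \<beta> * ln (R 0)) - (running_cost ?v S 0 + \<beta> * ln (S 0)) - \<delta> * \<Gamma> 0"
      unfolding running_cost_0[OF u] running_cost_0[OF S] running_cost_T[OF u] running_cost_T[OF S]
        R_start[OF u] S0
      using opt[OF S] by (simp add: right_diff_distrib)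
  qed (use T gap in auto)
  then have "negligible {t \<in> {0..T}. R t \<noteq> S t}"
    by (rule negligible_subset) (use gap in auto)
  then show ?thesis
    by (rule same_state_imp_same_control[OF u S R0_pos])
qed

section \<open>Switching times and the case distinction\<close>

text \<open>Under full control \<open>\<alpha> * (T - t) * \<rho> t\<close> falls from above
  \<open>\<beta>\<close> to zero, so it equals \<open>\<beta>\<close> at some \<open>\<tau>\<close>.
  If the state is still at least \<open>Rs\<close> then, the control is switched off at
  \<open>\<tau>\<close>; otherwise \<open>\<rho>\<close> has met \<open>Rs\<close> earlier and a
  singular arc is inserted there.\<close>

lemma switching_times:
  assumes R0_gt: "Rs < R0" and long: "\<beta> < \<alpha> * T * R0"
  defines "\<rho> \<equiv> \<lambda>t. a / u1 + (R0 - a / u1) * exp (- u1 * t)"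
  obtains t1 t2 where "0 < t1" "t1 \<le> t2" "t2 < T" "t1 = t2 \<or> \<rho> t1 = Rs"
    "Rs \<le> \<rho> t1" "\<alpha> * (T - t2) * \<rho> t1 = \<beta>"
proof -
  have cont: "continuous_on {0..t} \<rho>" for t
    unfolding \<rho>_def by (intro continuous_intros)
  have \<rho>0: "\<rho> 0 = R0" by (simp add: \<rho>_def)
  have "\<exists>\<tau>\<ge>0. \<tau> \<le> T \<and> \<alpha> * (T - \<tau>) * \<rho> \<tau> = \<beta>"
    by (rule IVT2') (use long \<rho>0 \<beta> T in \<open>auto intro!: continuous_intros cont\<close>)
  then obtain \<tau> where \<tau>: "0 \<le> \<tau>" "\<tau> \<le> T" "\<alpha> * (T - \<tau>) * \<rho> \<tau> = \<beta>" by blast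
  have \<tau>_less: "0 < \<tau>" "\<tau> < T"
    using \<tau> long \<rho>0 \<beta> by (cases "\<tau> = 0"; cases "\<tau> = T"; force)+
  show thesis
  proof (cases "Rs \<le> \<rho> \<tau>")
    case True
    then show ?thesis using \<tau> \<tau>_less by (intro that[of \<tau> \<tau>]) auto
  next
    case False
    have "\<exists>t\<ge>0. t \<le> \<tau> \<and> \<rho> t = Rs"
      by (rule IVT2') (use False \<rho>0 R0_gt \<tau>_less in \<open>auto intro!: cont\<close>)
    then obtain t1 where t1: "0 \<le> t1" "t1 \<le> \<tau>" "\<rho> t1 = Rs" by blast
    have "t1 \<noteq> 0" using t1 \<rho>0 R0_gt by auto
    \<comment> \<open>At this time the switching condition holds for a state resting at
      \<open>Rs\<close>, since \<open>\<alpha> * (Rs / a) * Rs = \<beta>\<close>.\<close>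
    define t2 where "t2 = T - Rs / a"
    have "\<alpha> * (T - t2) * Rs = \<beta>"
      using Rs_sq a by (simp add: t2_def power2_eq_square field_simps)
    moreover have "\<tau> < t2"
    proof (rule ccontr)
      assume "\<not> \<tau> < t2"
      then have "\<alpha> * (T - \<tau>) \<le> \<alpha> * (T - t2)" using \<alpha> by simp
      then have "\<alpha> * (T - \<tau>) * Rs \<le> \<beta>"
        using calculation Rs by (metis mult_right_mono less_imp_le)
      moreover have "\<alpha> * (T - \<tau>) * \<rho> \<tau> < \<alpha> * (T - \<tau>) * Rs"
        using False \<alpha> \<tau>_less by (intro mult_strict_left_mono) auto
      ultimately show False using \<tau> by simp
    qed
    moreover have "t2 < T" using Rs a by (simp add: t2_def)
    ultimately show ?thesis using t1 \<open>t1 \<noteq> 0\<close> by (intro that[of t1 t2]) auto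
  qed
qed

lemma optimal_forms:
  assumes u: "trajectory u R"
    and opt: "\<And>v S. trajectory v S \<Longrightarrow> cost T \<alpha> \<beta> u R \<le> cost T \<alpha> \<beta> v S"
  shows "\<exists>t1 t2. 0 < t1 \<and> t1 < t2 \<and> t2 < T \<and>
     (ae_eq_on T u (\<lambda>t. 0)
    \<or> ae_eq_on T u (\<lambda>t. if t < t1 then u1 else 0)
    \<or> ae_eq_on T u (\<lambda>t. if t < t1 then a / Rs else 0)
    \<or> ae_eq_on T u (\<lambda>t. if t < t1 then 0 else if t < t2 then a / Rs else 0)
    \<or> ae_eq_on T u (\<lambda>t. if t < t1 then u1 else if t < t2 then a / Rs else 0))"
    (is "\<exists>t1 t2. _ \<and> _ \<and> _ \<and> ?P t1 t2")
proof -
  \<comment> \<open>Midpoints supply a second time for the forms with a single switching.\<close>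
  have mean_between: "s < (s + T) / 2" "(s + T) / 2 < T" if "s < T" for s
    using that by simp_all
  have witness: ?thesis if "0 < s" "s < r" "r < T" "?P s r" for s r
    using that by (intro exI conjI)
  consider (short) "R0 + a * T \<le> 2 * Rs" | (low) "R0 \<le> Rs" "2 * Rs < R0 + a * T"
    | (high_short) "Rs < R0" "\<alpha> * T * R0 \<le> \<beta>" | (high) "Rs < R0" "\<beta> < \<alpha> * T * R0"
    by force
  then show ?thesis
  proof cases
    case short
    \<comment> \<open>Completing the square in \<open>t\<close>: the subtracted square vanishes
      exactly at the vertex \<open>?t0\<close> below, so the maximum over all \<open>t\<close> is
      \<open>\<alpha> * (R0 + a * T)^2 / (4 * a)\<close>.\<close>
    have square: "\<alpha> * (T - t) * (R0 + a * t) * (4 * a)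
       = \<alpha> * (R0 + a * T)\<^sup>2 - \<alpha> * (R0 + 2 * a * t - a * T)\<^sup>2" for t
      by (simp add: power2_eq_square algebra_simps)
    have "\<alpha> * (R0 + a * T)\<^sup>2 \<le> \<alpha> * (2 * Rs)\<^sup>2"
      using short R0 a T \<alpha> by (intro mult_left_mono power_mono) auto
    also have "\<dots> = \<beta> * (4 * a)" using Rs_sq by (simp add: power_mult_distrib)
    finally have bound: "\<alpha> * (R0 + a * T)\<^sup>2 \<le> \<beta> * (4 * a)" .
    let ?t0 = "(a * T - R0) / (2 * a)"
    have "ae_eq_on T u (\<lambda>t. 0)"
    proof (rule optimal_zero[OF u opt, of ?t0])
      fix t assume "t \<noteq> ?t0"
      then have "(R0 + 2 * a * t - a * T)\<^sup>2 > 0" using a by (auto simp: field_simps)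
      then have "\<alpha> * (R0 + 2 * a * t - a * T)\<^sup>2 > 0" using \<alpha> by simp
      then have "\<alpha> * (T - t) * (R0 + a * t) * (4 * a) < \<beta> * (4 * a)"
        using bound unfolding square by linarith
      then show "\<alpha> * (T - t) * (R0 + a * t) < \<beta>" using a by simp
    next
      have "\<alpha> * (R0 + 2 * a * ?t0 - a * T)\<^sup>2 \<ge> 0" using \<alpha> by simp
      then have "\<alpha> * (T - ?t0) * (R0 + a * ?t0) * (4 * a) \<le> \<beta> * (4 * a)"
        using bound unfolding square by linarith
      then show "\<alpha> * (T - ?t0) * (R0 + a * ?t0) \<le> \<beta>" using a by simp
    qed
    then show ?thesis using T by (intro witness[of "T / 3" "2 * T / 3"]) auto
  next
    case high_short
    \<comment> \<open>The aim is \<open>a * T \<le> R0\<close>: the vertex of the same parabola is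
      then not to the right of zero, so the parabola decreases on the whole interval from a value at
      most \<open>\<beta>\<close>.\<close>
    have "\<alpha> * (a * T) * R0 = a * (\<alpha> * T * R0)" by simp
    also have "\<dots> \<le> a * \<beta>" using high_short a by simp
    also have "\<dots> = \<alpha> * Rs\<^sup>2" using Rs_sq by simp
    also have "\<dots> \<le> \<alpha> * R0\<^sup>2" using high_short Rs \<alpha> by (intro mult_left_mono power_mono) auto
    finally have "a * T \<le> R0" using \<alpha> high_short Rs by (simp add: power2_eq_square)
    have "ae_eq_on T u (\<lambda>t. 0)"
    proof (rule optimal_zero[OF u opt, of 0])
      fix t assume t: "t \<in> {0..T}" "t \<noteq> 0"
      have "\<alpha> * (T - t) * (R0 + a * t) = \<alpha> * T * R0 - \<alpha> * t * (R0 - a * T) - \<alpha> * a * t\<^sup>2"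
        by (simp add: power2_eq_square algebra_simps)
      moreover have "0 \<le> \<alpha> * t * (R0 - a * T)" "0 < \<alpha> * a * t\<^sup>2"
        using \<open>a * T \<le> R0\<close> \<alpha> a t by auto
      ultimately show "\<alpha> * (T - t) * (R0 + a * t) < \<beta>" using high_short by linarith
    next
      show "\<alpha> * (T - 0) * (R0 + a * 0) \<le> \<beta>" using high_short(2) by simp
    qed
    then show ?thesis using T by (intro witness[of "T / 3" "2 * T / 3"]) auto
  next
    case low
    let ?t1 = "(Rs - R0) / a" and ?t2 = "T - Rs / a"
    have form: "ae_eq_on T u (\<lambda>t. if t < ?t1 then 0 else if t < ?t2 then a / Rs else 0)"
      by (rule optimal_singular[OF u opt low])
    have "?t2 - ?t1 = (R0 + a * T - 2 * Rs) / a" using a by (simp add: field_simps)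
    then have "?t2 - ?t1 > 0" using low a by simp
    then have t12: "0 \<le> ?t1" "?t1 < ?t2" "?t2 < T" using low a Rs by auto
    show ?thesis
    proof (cases "?t1 = 0")
      \<comment> \<open>Starting exactly at \<open>Rs\<close>, the initial arc is empty and
        \<open>?t2\<close> becomes the only switching time.\<close>
      case True
      have third: "ae_eq_on T u (\<lambda>t. if t < ?t2 then a / Rs else 0)"
        unfolding ae_eq_on_def
        by (rule negligible_subset[OF form[unfolded ae_eq_on_def True]]) auto
      show ?thesis
        by (rule witness[OF le_less_trans[OF t12(1,2)] mean_between[OF t12(3)]])
           (rule disjI2, rule disjI2, rule disjI1, rule third)
    next
      case False
      then have "0 < ?t1" using t12(1) by linarith
      then show ?thesis
        by (rule witness[OF _ t12(2,3)]) (rule disjI2, rule disjI2, rule disjI2, rule disjI1, rule form)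
    qed
  next
    case high
    let ?\<rho> = "\<lambda>t. a / u1 + (R0 - a / u1) * exp (- u1 * t)"
    obtain t1 t2 where t12: "0 < t1" "t1 \<le> t2" "t2 < T" and mid: "t1 = t2 \<or> ?\<rho> t1 = Rs"
      and last: "Rs \<le> ?\<rho> t1" "\<alpha> * (T - t2) * ?\<rho> t1 = \<beta>"
      by (rule switching_times[OF high])
    have form: "ae_eq_on T u (\<lambda>t. if t < t1 then u1 else if t < t2 then a / Rs else 0)"
      by (rule optimal_full_start[OF u opt high(1) t12 _ last]) (use mid in blast)+
    show ?thesis
    proof (cases "t1 = t2")
      \<comment> \<open>The singular arc is empty, so full control is followed directly by zero
        control.\<close>
      case True
      have second: "ae_eq_on T u (\<lambda>t. if t < t1 then u1 else 0)"
        unfolding ae_eq_on_def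
        by (rule negligible_subset[OF form[unfolded ae_eq_on_def]]) (use True in auto)
      have "t1 < T" using t12 by linarith
      show ?thesis
        by (rule witness[OF t12(1) mean_between[OF \<open>t1 < T\<close>]])
           (rule disjI2, rule disjI1, rule second)
    next
      case False
      then have "t1 < t2" using t12 by simp
      then show ?thesis
        by (rule witness[OF t12(1) _ t12(3)])
           (rule disjI2, rule disjI2, rule disjI2, rule disjI2, rule form)
    qed
  qed
qed

end

theorem theorem2:
  fixes T \<alpha> \<beta> \<sigma> u1 R0 :: real and N :: nat and u :: "real \<Rightarrow> real"
  assumes "T > 0" "\<alpha> > 0" "\<beta> > 0" "\<sigma> > 0" "u1 > 0" "N > 0" "R0 \<ge> 0"
    and "sqrt (\<alpha> * real N * \<sigma>\<^sup>2 / \<beta>) \<le> u1"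
    and "optimal_control T \<alpha> \<beta> \<sigma> u1 N R0 u"
  shows "\<exists>t1 t2. 0 < t1 \<and> t1 < t2 \<and> t2 < T \<and>
    (let us = sqrt (\<alpha> * real N * \<sigma>\<^sup>2 / \<beta>) in
      ae_eq_on T u (\<lambda>t. 0)
    \<or> ae_eq_on T u (\<lambda>t. if t < t1 then u1 else 0)
    \<or> ae_eq_on T u (\<lambda>t. if t < t1 then us else 0)
    \<or> ae_eq_on T u (\<lambda>t. if t < t1 then 0 else if t < t2 then us else 0)
    \<or> ae_eq_on T u (\<lambda>t. if t < t1 then u1 else if t < t2 then us else 0))"
proof -
  define a where "a = real N * \<sigma>\<^sup>2"
  define us where "us = sqrt (\<alpha> * real N * \<sigma>\<^sup>2 / \<beta>)"
  define Rs where "Rs = a / us"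
  have a: "a > 0" using assms by (simp add: a_def)
  have us: "us > 0" "us\<^sup>2 = \<alpha> * a / \<beta>" using assms by (simp_all add: us_def a_def mult.assoc)
  have us_eq: "a / Rs = us" using a us by (simp add: Rs_def)
  have "\<alpha> * Rs\<^sup>2 = a * \<beta>"
    using us a assms by (simp add: Rs_def power_divide) (simp add: power2_eq_square)
  then interpret control_problem T \<alpha> \<beta> a u1 R0 Rs
    using assms a us us_eq by unfold_locales (auto simp: Rs_def us_def)
  obtain R where adm: "admissible T u1 u" and R: "is_state T N \<sigma> R0 u R"
    and opt: "\<And>v S. admissible T u1 v \<Longrightarrow> is_state T N \<sigma> R0 v S \<Longrightarrow> cost T \<alpha> \<beta> u R \<le> cost T \<alpha> \<beta> v S"
    using assms unfolding optimal_control_def by blast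
  \<comment> \<open>The optimal control is replaced by an everywhere bounded representative with the
    same state and cost; \<open>trans\<close> carries the resulting form back.\<close>
  obtain w where w: "trajectory w R" "ae_eq_on T u w" "cost T \<alpha> \<beta> w R = cost T \<alpha> \<beta> u R"
    using trajectory_of_state[OF adm R a_def] by blast
  have "cost T \<alpha> \<beta> w R \<le> cost T \<alpha> \<beta> v S" if "trajectory v S" for v S
    using opt trajectory_is_state[OF that a_def] w(3) by simp
  note forms = optimal_forms[OF w(1) this, unfolded us_eq]
  have trans: "ae_eq_on T u f" if "ae_eq_on T w f" for f
  proof -
    have "negligible ({t \<in> {0..T}. u t \<noteq> w t} \<union> {t \<in> {0..T}. w t \<noteq> f t})"
      using w(2) that by (simp only: ae_eq_on_def negligible_Un_eq)
    then show ?thesis unfolding ae_eq_on_def by (rule negligible_subset) auto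
  qed
  show ?thesis
    unfolding Let_def us_def[symmetric] using forms trans by meson
qed

end
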